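(* Let $\mathbb{X}$ be a Polish space, $\mathfrak{q}$ an EPPF, $H$ a (not necessarily diffuse) probability measure on $\mathbb{X}$, and let $p=\sum_{j\ge 1}\tilde q_j\,\delta_{Z_j}\sim SSrp(\mathfrak{q},H)$ be proper (i.e. $\sum_j\tilde q_j=1$ a.s.). Let $(\tilde q_j^{\downarrow})_j$ be the weights of $p$ in decreasing order and let $(I_n)_{n\ge1}$ be conditionally independent given $(\tilde q_k^{\downarrow})_k$ with $\mathbb{P}\{I_n=j\mid(\tilde q_k^{\downarrow})_k\}=\tilde q_j^{\downarrow}$ for $j\ge 1$. Assume that $(I_n)_n$ and $(Z_j)_j$ are independent. Let $\Pi$ be an exchangeable random partition of $\mathbb{N}$ with EPPF $\mathfrak{q}$, also independent of $(Z_j)_j$. For every $n\ge1$ define $$\xi_n:=Z_{I_n}\qquad\text{and}\qquad \xi_n':=Z_{\mathscr{C}_n(\Pi)}.$$ Then: (i) the sequence $(\xi_n)_n$ is a $gSSS(\mathfrak{q},H)$; (ii) the sequences $(\xi_n)_n$ and $(\xi'_n)_n$ have the same law; (iii) for every $n\ge 1$ and any $A_1,\dots,A_n$ in the Borel $\sigma$-field of $\mathbb{X}$, $$\mathbb{P}\{\xi_1\in A_1,\dots,\xi_n\in A_n\}=\sum_{\pi_n\in\mathcal{P}_n}\mathfrak{q}(\pi_n)\prod_{c=1}^{|\pi_n|}H\Big(\bigcap_{j\in\pi_{c,n}}A_j\Big).$$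
   Context: Partitions. $\mathcal{P}_n$ is the set of partitions of $[n]=\{1,\dots,n\}$. A partition is written $\pi_n=[\pi_{1,n},\dots,\pi_{k,n}]$ with blocks listed in increasing order of their least elements; $|\pi_n|=k$ is the number of blocks and $|\pi_{c,n}|$ the size of block $c$. A random partition of $\mathbb{N}$ is a sequence $\Pi=(\Pi_n)_{n\ge1}$ with $\Pi_n$ taking values in $\mathcal{P}_n$ and such that the restriction of $\Pi_n$ to $[m]$ is $\Pi_m$ for $m<n$. It is exchangeable if for each $n$ the law of $\Pi_n$ is invariant under permutations of $[n]$; then there is a symmetric function $\mathfrak{q}$ of positive integers $(n_1,\dots,n_k)$, its exchangeable partition probability function (EPPF), with $\mathbb{P}\{\Pi_n=\pi_n\}=\mathfrak{q}(|\pi_{1,n}|,\dots,|\pi_{k,n}|)$ for all $n$ and $\pi_n\in\mathcal{P}_n$ with $k=|\pi_n|$. We write $\mathfrak{q}(\pi_n):=\mathfrak{q}(|\pi_{1,n}|,\dots,|\pi_{k,n}|)$. $\mathscr{C}_j(\Pi)$ denotes the (random) index $c$ of the block of $\Pi$ containing $j$, i.e. $\mathscr{C}_j(\Pi)=c$ if $j\in\Pi_{c,n}$ for some (equivalently all) $n\ge j$. Species sampling random probability. $p\sim SSrp(\mathfrak{q},H)$ means that $p=\sum_{j\ge1}\tilde q_j\delta_{Z_j}$, where $(Z_j)_j$ are i.i.d. with law $H$, independent of the nonnegative random weights $(\tilde q_j)_j$ with $\sum_j\tilde q_j=1$ a.s., and $\mathfrak{q}(n_1,\dots,n_k)=\sum_{j_1,\dots,j_k}\mathbb{E}\big[\prod_{i=1}^k\tilde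 q_{j_i}^{\,n_i}\big]$, the sum ranging over ordered $k$-tuples of distinct positive integers. Generalized species sampling sequence. A sequence $(\xi_n)_n$ is a $gSSS(\mathfrak{q},H)$ if it is exchangeable and its directing random measure has law $SSrp(\mathfrak{q},H)$, i.e. the $\xi_n$ are conditionally i.i.d. given a random probability measure with law $SSrp(\mathfrak{q},H)$, with that measure as common conditional distribution. *)

theory Defs
  imports "HOL-Probability.Probability" "HOL-Combinatorics.Permutations"
begin

text \<open>
  All indexing starts at 0: \<open>[n]\<close> is \<open>{..<n}\<close>, and the blocks of a partition, the weights, the
  atoms and the terms of a sequence are numbered \<open>0, 1, 2, \<dots>\<close>.
\<close>

section \<open>Exchangeable random partitions\<close>

definition partitions :: "nat \<Rightarrow> nat set set set" where
  "partitions n = {\<pi>. partition_on {..<n} \<pi>}"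

definition blocks :: "nat set set \<Rightarrow> nat set list" where
  "blocks \<pi> = sorted_key_list_of_set Min \<pi>"

lemma linorder_sorted_key_list_of_set:
  "linorder.sorted_key_list_of_set (\<le>) =
     (sorted_key_list_of_set :: ('b \<Rightarrow> 'a::linorder) \<Rightarrow> 'b set \<Rightarrow> 'b list)"
proof -
  have "linorder.insort_key (\<le>) f x xs = insort_key f x xs" for f :: "'b \<Rightarrow> 'a" and x xs
    by (induction xs) (simp_all add: linorder.insort_key.simps[OF linorder_axioms])
  then have "linorder.insort_key (\<le>) = (insort_key :: ('b \<Rightarrow> 'a) \<Rightarrow> _)"
    by (intro ext)
  then show ?thesis
    by (intro ext) (simp add: sorted_key_list_of_set_def
        linorder.sorted_key_list_of_set_def[OF linorder_axioms])
qed

lemma blocks_partition: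
  assumes "\<pi> \<in> partitions n"
  shows "set (blocks \<pi>) = \<pi>" "length (blocks \<pi>) = card \<pi>" "distinct (blocks \<pi>)"
    "sorted_wrt (<) (map Min (blocks \<pi>))"
proof -
  have p: "partition_on {..<n} \<pi>"
    using assms by (simp add: partitions_def)
  have fin: "finite \<pi>"
    using p finite_elements finite_lessThan by blast
  have inj: "inj_on Min \<pi>"
  proof (rule inj_onI)
    fix B C assume BC: "B \<in> \<pi>" "C \<in> \<pi>" "Min B = Min C"
    have "finite B" "finite C" "B \<noteq> {}" "C \<noteq> {}"
      using p BC partition_onD1[OF p] partition_onD3[OF p] finite_subset[of _ "{..<n}"]
      by blast+
    then have "Min B \<in> B" "Min B \<in> C"
      using BC Min_in by metis+
    then show "B = C"
      using p BC by (meson partition_onD2 disjointD disjoint_iff)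
  qed
  interpret folding_insort_key "(\<le>)" "(<)" \<pi> Min
    by unfold_locales (fact inj)
  note sorted = sorted_key_list_of_set[unfolded linorder_sorted_key_list_of_set, OF subset_refl]
  show "set (blocks \<pi>) = \<pi>"
    unfolding blocks_def by (rule sorted(1)) fact
  show "length (blocks \<pi>) = card \<pi>"
    unfolding blocks_def
    by (rule length_sorted_key_list_of_set[unfolded linorder_sorted_key_list_of_set, OF subset_refl])
  show "sorted_wrt (<) (map Min (blocks \<pi>))"
    unfolding blocks_def
    by (rule strict_sorted_key_list_of_set[unfolded linorder_sorted_key_list_of_set, OF subset_refl])
  then show "distinct (blocks \<pi>)"
    by (metis distinct_map strict_sorted_iff)
qed

definition restrict_partition :: "nat \<Rightarrow> nat set set \<Rightarrow> nat set set" where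
  "restrict_partition m \<pi> = (\<lambda>B. B \<inter> {..<m}) ` \<pi> - {{}}"

definition random_partition :: "'w measure \<Rightarrow> (nat \<Rightarrow> 'w \<Rightarrow> nat set set) \<Rightarrow> bool" where
  "random_partition M P \<longleftrightarrow>
     (\<forall>n. P n \<in> M \<rightarrow>\<^sub>M count_space (partitions n)) \<and>
     (\<forall>n. \<forall>m<n. \<forall>\<omega>\<in>space M. restrict_partition m (P n \<omega>) = P m \<omega>)"

definition exchangeable_partition :: "'w measure \<Rightarrow> (nat \<Rightarrow> 'w \<Rightarrow> nat set set) \<Rightarrow> bool" where
  "exchangeable_partition M P \<longleftrightarrow>
     random_partition M P \<and>
     (\<forall>n \<sigma>. \<sigma> permutes {..<n} \<longrightarrow>
        distr M (count_space (partitions n)) (\<lambda>\<omega>. (`) \<sigma> ` P n \<omega>) =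
        distr M (count_space (partitions n)) (P n))"

text \<open>
  An EPPF takes a tuple of positive integers, encoded as a nonempty list without zeros; its
  values on other lists are irrelevant.
\<close>

definition positive_tuple :: "nat list \<Rightarrow> bool" where
  "positive_tuple ns \<longleftrightarrow> ns \<noteq> [] \<and> (\<forall>n\<in>set ns. 0 < n)"

definition eppf_at :: "(nat list \<Rightarrow> real) \<Rightarrow> nat set set \<Rightarrow> real" where
  "eppf_at q \<pi> = q (map card (blocks \<pi>))"

definition has_eppf ::
  "'w measure \<Rightarrow> (nat \<Rightarrow> 'w \<Rightarrow> nat set set) \<Rightarrow> (nat list \<Rightarrow> real) \<Rightarrow> bool" where
  "has_eppf M P q \<longleftrightarrow>
     (\<forall>ns ms. positive_tuple ns \<longrightarrow> mset ms = mset ns \<longrightarrow> q ms = q ns) \<and>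
     (\<forall>n\<ge>1. \<forall>\<pi>\<in>partitions n. measure M {\<omega>\<in>space M. P n \<omega> = \<pi>} = eppf_at q \<pi>)"

definition block_index :: "(nat \<Rightarrow> 'w \<Rightarrow> nat set set) \<Rightarrow> nat \<Rightarrow> 'w \<Rightarrow> nat" where
  "block_index P j \<omega> =
     (THE c. \<exists>n>j. c < length (blocks (P n \<omega>)) \<and> j \<in> blocks (P n \<omega>) ! c)"

section \<open>Independence and conditional independence\<close>

definition sigma_gen :: "'w measure \<Rightarrow> 'b measure \<Rightarrow> ('w \<Rightarrow> 'b) \<Rightarrow> 'w measure" where
  "sigma_gen M N X = vimage_algebra (space M) X N"

text \<open>The library's \<open>indep_var\<close> requires both random variables to have the same type.\<close>

definition indep_rv ::
  "'w measure \<Rightarrow> 'a measure \<Rightarrow> ('w \<Rightarrow> 'a) \<Rightarrow> 'b measure \<Rightarrow> ('w \<Rightarrow> 'b) \<Rightarrow> bool" where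
  "indep_rv M N X L Y \<longleftrightarrow>
     X \<in> M \<rightarrow>\<^sub>M N \<and> Y \<in> M \<rightarrow>\<^sub>M L \<and>
     prob_space.indep_set M (sets (sigma_gen M N X)) (sets (sigma_gen M L Y))"

definition prob_given :: "'w measure \<Rightarrow> 'w measure \<Rightarrow> 'w set \<Rightarrow> 'w \<Rightarrow> real" where
  "prob_given M F E = real_cond_exp M F (indicator E)"

definition cond_indep_seq ::
  "'w measure \<Rightarrow> 'w measure \<Rightarrow> 'b measure \<Rightarrow> (nat \<Rightarrow> 'w \<Rightarrow> 'b) \<Rightarrow> bool" where
  "cond_indep_seq M F N X \<longleftrightarrow>
     (\<forall>i. X i \<in> M \<rightarrow>\<^sub>M N) \<and>
     (\<forall>J A. finite J \<longrightarrow> (\<forall>i\<in>J. A i \<in> sets N) \<longrightarrow>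
        (AE \<omega> in M. prob_given M F {\<omega>\<in>space M. \<forall>i\<in>J. X i \<omega> \<in> A i} \<omega> =
                    (\<Prod>i\<in>J. prob_given M F {\<omega>\<in>space M. X i \<omega> \<in> A i} \<omega>)))"

section \<open>Species sampling random probabilities\<close>

definition discrete_measure :: "(nat \<Rightarrow> real) \<Rightarrow> (nat \<Rightarrow> 'x::topological_space) \<Rightarrow> 'x measure" where
  "discrete_measure w z =
     measure_of UNIV (sets borel) (\<lambda>A. \<Sum>j. ennreal (w j) * emeasure (return borel (z j)) A)"

lemma sets_discrete_measure [simp]: "sets (discrete_measure w z) = sets borel"
  unfolding discrete_measure_def by (metis sets.sets_measure_of_eq space_borel)

lemma emeasure_discrete_measure:
  assumes A: "A \<in> sets borel"
  shows "emeasure (discrete_measure w z) A = (\<Sum>j. ennreal (w j) * indicator A (z j))"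
proof -
  let ?D = "distr (density (count_space UNIV) (\<lambda>j. ennreal (w j))) borel z"
  have *: "emeasure ?D B = (\<Sum>j. ennreal (w j) * emeasure (return borel (z j)) B)"
    if "B \<in> sets borel" for B
    using that
    by (simp add: emeasure_distr emeasure_density nn_integral_count_space_nat vimage_def
        indicator_def)
  have "discrete_measure w z = measure_of UNIV (sets borel) (emeasure ?D)"
    unfolding discrete_measure_def
    by (rule measure_of_eq) (auto simp: * sets.sigma_sets_eq[of borel, simplified])
  also have "\<dots> = ?D"
    using measure_of_of_measure[of ?D] by simp
  finally show ?thesis
    using *[OF A] A by simp
qed

text \<open>
  \<open>species_sampling M q H p w Z\<close>: on the probability space \<open>M\<close>, the random probability measure
  \<open>p\<close> is \<open>\<Sum>j. w j \<delta>(Z j)\<close>, and this representation witnesses \<open>p \<sim> SSrp(q, H)\<close>. The equation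
  holds almost surely only, since the weights may fail to sum to one on a null set.
\<close>

definition species_sampling ::
  "'w measure \<Rightarrow> (nat list \<Rightarrow> real) \<Rightarrow> 'x::polish_space measure \<Rightarrow> ('w \<Rightarrow> 'x measure) \<Rightarrow>
   (nat \<Rightarrow> 'w \<Rightarrow> real) \<Rightarrow> (nat \<Rightarrow> 'w \<Rightarrow> 'x) \<Rightarrow> bool" where
  "species_sampling M q H p w Z \<longleftrightarrow>
     p \<in> M \<rightarrow>\<^sub>M prob_algebra borel \<and>
     (AE \<omega> in M. p \<omega> = discrete_measure (\<lambda>j. w j \<omega>) (\<lambda>j. Z j \<omega>)) \<and>
     (\<forall>j. w j \<in> borel_measurable M) \<and>
     (\<forall>j. \<forall>\<omega>\<in>space M. 0 \<le> w j \<omega>) \<and>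
     (AE \<omega> in M. (\<lambda>j. w j \<omega>) sums 1) \<and>
     prob_space.indep_vars M (\<lambda>_. borel) Z UNIV \<and>
     (\<forall>j. distr M borel (Z j) = H) \<and>
     indep_rv M (PiM UNIV (\<lambda>_. borel)) (\<lambda>\<omega> j. w j \<omega>)
                (PiM UNIV (\<lambda>_. borel)) (\<lambda>\<omega> j. Z j \<omega>) \<and>
     (\<forall>ns. positive_tuple ns \<longrightarrow>
        ((\<lambda>js. \<integral>\<omega>. (\<Prod>i<length ns. w (js ! i) \<omega> ^ (ns ! i)) \<partial>M) has_sum q ns)
          {js. length js = length ns \<and> distinct js})"

text \<open>
  Quantifying over representations on this one sample space type is no restriction: every
  representation can be transported to the joint law of the weights and the atoms.
\<close>

definition SSrp_law ::
  "(nat list \<Rightarrow> real) \<Rightarrow> 'x::polish_space measure \<Rightarrow> 'x measure measure \<Rightarrow> bool" where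
  "SSrp_law q H \<mu> \<longleftrightarrow>
     (\<exists>(N :: ((nat \<Rightarrow> real) \<times> (nat \<Rightarrow> 'x)) measure) p w Z.
        prob_space N \<and> species_sampling N q H p w Z \<and> \<mu> = distr N (prob_algebra borel) p)"

definition decreasing_rearrangement :: "(nat \<Rightarrow> real) \<Rightarrow> (nat \<Rightarrow> real) \<Rightarrow> bool" where
  "decreasing_rearrangement w v \<longleftrightarrow>
     decseq v \<and> (\<forall>k. 0 \<le> v k) \<and>
     (\<exists>f. bij_betw f {k. 0 < v k} {j. 0 < w j} \<and> (\<forall>k. 0 < v k \<longrightarrow> v k = w (f k)))"

section \<open>Generalized species sampling sequences\<close>

definition exchangeable_seq :: "'w measure \<Rightarrow> (nat \<Rightarrow> 'w \<Rightarrow> 'x::polish_space) \<Rightarrow> bool" where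
  "exchangeable_seq M \<xi> \<longleftrightarrow>
     (\<forall>n. \<xi> n \<in> borel_measurable M) \<and>
     (\<forall>n \<sigma>. \<sigma> permutes {..<n} \<longrightarrow>
        distr M (PiM UNIV (\<lambda>_. borel)) (\<lambda>\<omega> i. \<xi> (\<sigma> i) \<omega>) =
        distr M (PiM UNIV (\<lambda>_. borel)) (\<lambda>\<omega> i. \<xi> i \<omega>))"

definition cond_iid_given ::
  "'w measure \<Rightarrow> (nat \<Rightarrow> 'w \<Rightarrow> 'x::polish_space) \<Rightarrow> ('w \<Rightarrow> 'x measure) \<Rightarrow> bool" where
  "cond_iid_given M \<xi> p \<longleftrightarrow>
     p \<in> M \<rightarrow>\<^sub>M prob_algebra borel \<and>
     cond_indep_seq M (sigma_gen M (prob_algebra borel) p) borel \<xi> \<and>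
     (\<forall>n. \<forall>A\<in>sets borel. AE \<omega> in M.
        prob_given M (sigma_gen M (prob_algebra borel) p) {\<omega>\<in>space M. \<xi> n \<omega> \<in> A} \<omega> =
        measure (p \<omega>) A)"

definition gSSS ::
  "'w measure \<Rightarrow> (nat list \<Rightarrow> real) \<Rightarrow> 'x::polish_space measure \<Rightarrow> (nat \<Rightarrow> 'w \<Rightarrow> 'x) \<Rightarrow> bool" where
  "gSSS M q H \<xi> \<longleftrightarrow>
     exchangeable_seq M \<xi> \<and>
     (\<exists>p. cond_iid_given M \<xi> p \<and> SSrp_law q H (distr M (prob_algebra borel) p))"

end

theory Submission
  imports Defs
begin

text \<open>
  Given a sequence \<open>i\<close> of indices, the atoms \<open>Z (i 0), Z (i 1), \<dots>\<close> depend on \<open>i\<close> only through the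
  partition of the positions by equal index, which gives the product formula of (iii) for any
  random index sequence independent of the atoms. It applies both to \<open>I\<close> and to the block indices
  of the exchangeable partition; the two induced partitions have the same law \<open>q\<close>, whence (ii) and
  (iii). For (i), the directing measure is \<open>\<Sum>k. wdec k \<delta>(Z k)\<close>. Only \<open>I\<close>, not the pair of \<open>I\<close>
  and \<open>wdec\<close>, is assumed to be independent of the atoms, but by the law of large numbers \<open>wdec\<close> is
  almost surely a function of \<open>I\<close>, so that one may condition on the atoms by Fubini's theorem.
\<close>

section \<open>Independence and random indices\<close>


text \<open>The directing measure puts the k-th largest weight on the k-th atom, so in general it is
  not the measure \<open>p\<close> of the hypothesis; it only shares its law. This works because the
  sum over tuples of distinct indices that defines \<open>q\<close> does not change when the weights
  are rearranged, and because the recovered weights are again independent of the i.i.d. atoms. The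
  weights are only almost surely nonnegative with sum one, whereas a measurable map into
  \<open>prob_algebra\<close> must give a probability measure at every point. Hence the weights are
  replaced by a function of the indices whose every value is a probability vector. Conditional
  probabilities given the directing measure are checked by integrating over the events that it lies
  in a set B. Once the atoms are frozen, such an event concerns the weights alone, so the
  conditional law of the indices given the weights applies to it.\<close>

lemma indep_rv_iff:
  assumes "prob_space M"
  shows "indep_rv M N X L Y \<longleftrightarrow> X \<in> M \<rightarrow>\<^sub>M N \<and> Y \<in> M \<rightarrow>\<^sub>M L \<and>
    (\<forall>A\<in>sets N. \<forall>B\<in>sets L. measure M {\<omega>\<in>space M. X \<omega> \<in> A \<and> Y \<omega> \<in> B} =
       measure M {\<omega>\<in>space M. X \<omega> \<in> A} * measure M {\<omega>\<in>space M. Y \<omega> \<in> B})"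
proof -
  interpret prob_space M by fact
  have "indep_set (sets (sigma_gen M N X)) (sets (sigma_gen M L Y)) \<longleftrightarrow>
    (\<forall>A\<in>sets N. \<forall>B\<in>sets L. prob {\<omega>\<in>space M. X \<omega> \<in> A \<and> Y \<omega> \<in> B} =
       prob {\<omega>\<in>space M. X \<omega> \<in> A} * prob {\<omega>\<in>space M. Y \<omega> \<in> B})"
    if X: "X \<in> M \<rightarrow>\<^sub>M N" and Y: "Y \<in> M \<rightarrow>\<^sub>M L"
  proof -
    \<comment> \<open>The preimages under one map already form a sigma-algebra, so the product rule
      on preimages is all of independence and no generator argument is needed.\<close>
    have sX: "sets (sigma_gen M N X) = (\<lambda>A. {\<omega>\<in>space M. X \<omega> \<in> A}) ` sets N"
      using measurable_space[OF X] unfolding sigma_gen_def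
      by (subst sets_vimage_algebra2) (auto simp: vimage_def Int_def conj_commute)
    have sY: "sets (sigma_gen M L Y) = (\<lambda>A. {\<omega>\<in>space M. Y \<omega> \<in> A}) ` sets L"
      using measurable_space[OF Y] unfolding sigma_gen_def
      by (subst sets_vimage_algebra2) (auto simp: vimage_def Int_def conj_commute)
    have int: "{\<omega>\<in>space M. X \<omega> \<in> A} \<inter> {\<omega>\<in>space M. Y \<omega> \<in> B} =
      {\<omega>\<in>space M. X \<omega> \<in> A \<and> Y \<omega> \<in> B}" for A B by auto
    have "(\<lambda>A. {\<omega>\<in>space M. X \<omega> \<in> A}) ` sets N \<subseteq> events"
      "(\<lambda>A. {\<omega>\<in>space M. Y \<omega> \<in> A}) ` sets L \<subseteq> events"
      using X Y by (auto intro: measurable_sets_Collect)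
    then show ?thesis
      unfolding sX sY indep_sets2_eq by (simp add: int)
  qed
  then show ?thesis
    unfolding indep_rv_def by blast
qed

text \<open>The equation for \<open>X'\<close> is asked for on the sample space only, because
  outside it nothing is known about the partitions and hence about block indices.\<close>

lemma indep_rv_compose_left:
  assumes "prob_space M" and ind: "indep_rv M N X L Y" and f: "f \<in> N \<rightarrow>\<^sub>M N'"
    and X': "\<And>\<omega>. \<omega> \<in> space M \<Longrightarrow> X' \<omega> = f (X \<omega>)"
  shows "indep_rv M N' X' L Y"
  unfolding indep_rv_iff[OF assms(1)]
proof (intro conjI ballI)
  note ind' = ind[unfolded indep_rv_iff[OF assms(1)]]
  have "(\<lambda>\<omega>. f (X \<omega>)) \<in> M \<rightarrow>\<^sub>M N'"
    using ind' f by auto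
  then show "X' \<in> M \<rightarrow>\<^sub>M N'" by (simp add: X' cong: measurable_cong)
  show "Y \<in> M \<rightarrow>\<^sub>M L" using ind' by simp
  fix A B assume A: "A \<in> sets N'" and B: "B \<in> sets L"
  have "{\<omega>\<in>space M. X' \<omega> \<in> A \<and> Q \<omega>} = {\<omega>\<in>space M. X \<omega> \<in> f -` A \<inter> space N \<and> Q \<omega>}" for Q
    using ind' X' by (auto dest: measurable_space)
  note eq = this[of "\<lambda>\<omega>. Y \<omega> \<in> B"] this[of "\<lambda>_. True", simplified]
  have "f -` A \<inter> space N \<in> sets N" using measurable_sets[OF f A] .
  then have "measure M {\<omega>\<in>space M. X \<omega> \<in> f -` A \<inter> space N \<and> Y \<omega> \<in> B} =
      measure M {\<omega>\<in>space M. X \<omega> \<in> f -` A \<inter> space N} * measure M {\<omega>\<in>space M. Y \<omega> \<in> B}"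
    using ind' B by blast
  then show "measure M {\<omega>\<in>space M. X' \<omega> \<in> A \<and> Y \<omega> \<in> B} =
      measure M {\<omega>\<in>space M. X' \<omega> \<in> A} * measure M {\<omega>\<in>space M. Y \<omega> \<in> B}"
    unfolding eq by simp
qed

lemma distr_Pair_indep_rv:
  assumes "prob_space M" and ind: "indep_rv M N X L Y"
  shows "distr M (N \<Otimes>\<^sub>M L) (\<lambda>\<omega>. (X \<omega>, Y \<omega>)) = distr M N X \<Otimes>\<^sub>M distr M L Y"
proof -
  interpret prob_space M by fact
  note ind' = ind[unfolded indep_rv_iff[OF assms(1)]]
  have [measurable]: "X \<in> M \<rightarrow>\<^sub>M N" "Y \<in> M \<rightarrow>\<^sub>M L" using ind' by auto
  interpret X: prob_space "distr M N X" by (rule prob_space_distr) simp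
  interpret Y: prob_space "distr M L Y" by (rule prob_space_distr) simp
  show ?thesis
  proof (rule pair_measure_eqI[symmetric])
    fix A B assume "A \<in> sets (distr M N X)" "B \<in> sets (distr M L Y)"
    then have [measurable]: "A \<in> sets N" "B \<in> sets L" by auto
    have "emeasure (distr M (N \<Otimes>\<^sub>M L) (\<lambda>\<omega>. (X \<omega>, Y \<omega>))) (A \<times> B) =
        emeasure M {\<omega>\<in>space M. X \<omega> \<in> A \<and> Y \<omega> \<in> B}"
      by (subst emeasure_distr) (auto intro!: arg_cong[where f="emeasure M"])
    also have "\<dots> = emeasure M {\<omega>\<in>space M. X \<omega> \<in> A} * emeasure M {\<omega>\<in>space M. Y \<omega> \<in> B}"
      using ind' by (simp add: emeasure_eq_measure ennreal_mult)
    also have "\<dots> = emeasure (distr M N X) A * emeasure (distr M L Y) B"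
      by (auto simp: emeasure_distr intro!: arg_cong2[where f="(*)"] arg_cong[where f="emeasure M"])
    finally show "emeasure (distr M N X) A * emeasure (distr M L Y) B =
        emeasure (distr M (N \<Otimes>\<^sub>M L) (\<lambda>\<omega>. (X \<omega>, Y \<omega>))) (A \<times> B)" by simp
  qed (auto intro: X.sigma_finite_measure_axioms Y.sigma_finite_measure_axioms cong: sets_pair_measure_cong)
qed

text \<open>Both orders of integration are needed: freezing the indices and averaging over the atoms
  gives the product formula, freezing the atoms and averaging over the indices gives the conditional
  law.\<close>

lemma nn_integral_indep_rv:
  assumes "prob_space M" and ind: "indep_rv M N X L Y"
    and [measurable]: "f \<in> borel_measurable (N \<Otimes>\<^sub>M L)"
  shows "(\<integral>\<^sup>+\<omega>. f (X \<omega>, Y \<omega>) \<partial>M) = (\<integral>\<^sup>+\<omega>. (\<integral>\<^sup>+\<omega>'. f (X \<omega>, Y \<omega>') \<partial>M) \<partial>M)"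
    and "(\<integral>\<^sup>+\<omega>. f (X \<omega>, Y \<omega>) \<partial>M) = (\<integral>\<^sup>+\<omega>'. (\<integral>\<^sup>+\<omega>. f (X \<omega>, Y \<omega>') \<partial>M) \<partial>M)"
proof -
  interpret prob_space M by fact
  have [measurable]: "X \<in> M \<rightarrow>\<^sub>M N" "Y \<in> M \<rightarrow>\<^sub>M L" using ind by (auto simp: indep_rv_def)
  interpret X: prob_space "distr M N X" by (rule prob_space_distr) simp
  interpret Y: prob_space "distr M L Y" by (rule prob_space_distr) simp
  interpret XY: pair_sigma_finite "distr M N X" "distr M L Y" ..
  have sp: "X \<omega> \<in> space N" "Y \<omega> \<in> space L" if "\<omega> \<in> space M" for \<omega>
    using measurable_space[OF \<open>X \<in> M \<rightarrow>\<^sub>M N\<close> that] measurable_space[OF \<open>Y \<in> M \<rightarrow>\<^sub>M L\<close> that] .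
  have "(\<integral>\<^sup>+\<omega>. f (X \<omega>, Y \<omega>) \<partial>M) = (\<integral>\<^sup>+x. f x \<partial>(distr M N X \<Otimes>\<^sub>M distr M L Y))"
    unfolding distr_Pair_indep_rv[OF assms(1,2), symmetric] by (subst nn_integral_distr) auto
  also have "\<dots> = (\<integral>\<^sup>+x. (\<integral>\<^sup>+y. f (x, y) \<partial>distr M L Y) \<partial>distr M N X)"
    by (subst Y.nn_integral_fst[symmetric]) auto
  also have "\<dots> = (\<integral>\<^sup>+\<omega>. (\<integral>\<^sup>+\<omega>'. f (X \<omega>, Y \<omega>') \<partial>M) \<partial>M)"
    by (subst nn_integral_distr; measurable)
       (auto simp: sp intro!: nn_integral_cong nn_integral_distr)
  finally show 1: "(\<integral>\<^sup>+\<omega>. f (X \<omega>, Y \<omega>) \<partial>M) = (\<integral>\<^sup>+\<omega>. (\<integral>\<^sup>+\<omega>'. f (X \<omega>, Y \<omega>') \<partial>M) \<partial>M)" .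
  have "(\<integral>\<^sup>+\<omega>. f (X \<omega>, Y \<omega>) \<partial>M) = (\<integral>\<^sup>+x. f x \<partial>(distr M N X \<Otimes>\<^sub>M distr M L Y))"
    unfolding distr_Pair_indep_rv[OF assms(1,2), symmetric] by (subst nn_integral_distr) auto
  also have "\<dots> = (\<integral>\<^sup>+y. (\<integral>\<^sup>+x. f (x, y) \<partial>distr M N X) \<partial>distr M L Y)"
    by (subst XY.nn_integral_snd[symmetric]) auto
  also have "\<dots> = (\<integral>\<^sup>+\<omega>'. (\<integral>\<^sup>+\<omega>. f (X \<omega>, Y \<omega>') \<partial>M) \<partial>M)"
    by (subst nn_integral_distr; measurable)
       (auto simp: sp intro!: nn_integral_cong nn_integral_distr)
  finally show "(\<integral>\<^sup>+\<omega>. f (X \<omega>, Y \<omega>) \<partial>M) = (\<integral>\<^sup>+\<omega>'. (\<integral>\<^sup>+\<omega>. f (X \<omega>, Y \<omega>') \<partial>M) \<partial>M)" .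
qed

section \<open>Partitions induced by index sequences, and the atoms they select\<close>

definition kernel_partition :: "nat \<Rightarrow> (nat \<Rightarrow> nat) \<Rightarrow> nat set set" where
  "kernel_partition n i = (\<lambda>k. {j. j < n \<and> i j = k}) ` (i ` {..<n})"

lemma kernel_partition_in_partitions: "kernel_partition n i \<in> partitions n"
  unfolding partitions_def mem_Collect_eq
  by (rule partition_onI) (auto simp: kernel_partition_def disjnt_def)

lemma partitionsD:
  assumes "\<pi> \<in> partitions n" "B \<in> \<pi>"
  shows "B \<subseteq> {..<n}" "finite B" "B \<noteq> {}" "C \<in> \<pi> \<Longrightarrow> j \<in> B \<Longrightarrow> j \<in> C \<Longrightarrow> C = B"
proof -
  have p: "partition_on {..<n} \<pi>" using assms by (simp add: partitions_def)
  then show "B \<subseteq> {..<n}" "B \<noteq> {}" 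
    using assms partition_onD1[OF p] partition_onD3[OF p] by blast+
  then show "finite B" using finite_subset by blast
  show "C \<in> \<pi> \<Longrightarrow> j \<in> B \<Longrightarrow> j \<in> C \<Longrightarrow> C = B"
    using partition_onD2[OF p] assms(2) by (metis disjointD disjoint_iff)
qed

lemma partitions_cover:
  assumes "\<pi> \<in> partitions n" "j < n"
  obtains B where "B \<in> \<pi>" "j \<in> B"
proof -
  have "partition_on {..<n} \<pi>" using assms by (simp add: partitions_def)
  then show ?thesis using assms that partition_onD1 by blast
qed

text \<open>A partition is determined by its equivalence relation. In this form the event of having
  a given kernel is a finite combination of coincidences between two indices, which makes it
  measurable.\<close>

lemma kernel_partition_eq_iff:
  assumes "\<pi> \<in> partitions n"
  shows "kernel_partition n i = \<pi> \<longleftrightarrow> (\<forall>a<n. \<forall>b<n. i a = i b \<longleftrightarrow> (\<exists>B\<in>\<pi>. a \<in> B \<and> b \<in> B))"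
proof
  assume "kernel_partition n i = \<pi>"
  then have \<pi>: "\<pi> = (\<lambda>k. {j. j < n \<and> i j = k}) ` i ` {..<n}" by (simp add: kernel_partition_def)
  show "\<forall>a<n. \<forall>b<n. i a = i b \<longleftrightarrow> (\<exists>B\<in>\<pi>. a \<in> B \<and> b \<in> B)"
    unfolding \<pi> by auto
next
  assume eq: "\<forall>a<n. \<forall>b<n. i a = i b \<longleftrightarrow> (\<exists>B\<in>\<pi>. a \<in> B \<and> b \<in> B)"
  \<comment> \<open>Every block is the fibre of \<open>i\<close> through any one of its
    elements.\<close>
  have B: "B = {j. j < n \<and> i j = i a}" if B: "B \<in> \<pi>" "a \<in> B" for a B
  proof (intro set_eqI iffI)
    have lt: "B \<subseteq> {..<n}" using partitionsD(1)[OF assms B(1)] .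
    show "j \<in> {j. j < n \<and> i j = i a}" if "j \<in> B" for j
      using eq B lt that by blast
    fix j assume "j \<in> {j. j < n \<and> i j = i a}"
    then obtain C where "C \<in> \<pi>" "j \<in> C" "a \<in> C" using eq B lt by blast
    then show "j \<in> B" using partitionsD(4)[OF assms B(1) _ B(2)] by blast
  qed
  show "kernel_partition n i = \<pi>"
  proof (intro set_eqI iffI)
    fix B assume "B \<in> kernel_partition n i"
    then obtain a where "a < n" "B = {j. j < n \<and> i j = i a}" by (auto simp: kernel_partition_def)
    moreover obtain C where "C \<in> \<pi>" "a \<in> C" using partitions_cover[OF assms \<open>a < n\<close>] .
    ultimately show "B \<in> \<pi>" using B[of C a] by simp
  next
    fix B assume "B \<in> \<pi>"
    note sub = partitionsD[OF assms this]
    then obtain a where "a \<in> B" by blast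
    then have "B = {j. j < n \<and> i j = i a}" "a < n" using B[OF \<open>B \<in> \<pi>\<close>] sub(1) by blast+
    then show "B \<in> kernel_partition n i" by (simp add: kernel_partition_def)
  qed
qed

lemma finite_partitions: "finite (partitions n)"
  unfolding partitions_def by (rule finitely_many_partition_on) simp

lemma sets_kernel_partition:
  assumes [measurable]: "\<And>j. J j \<in> M \<rightarrow>\<^sub>M count_space UNIV" and "\<pi> \<in> partitions n"
  shows "{\<omega>\<in>space M. kernel_partition n (\<lambda>j. J j \<omega>) = \<pi>} \<in> sets M"
proof -
  have eq: "{\<omega>\<in>space M. J a \<omega> = J b \<omega>} \<in> sets M" for a b
  proof -
    \<comment> \<open>Naming the common value presents the coincidence as a countable union of
      measurable events.\<close>
    have "{\<omega>\<in>space M. \<exists>k. J a \<omega> = k \<and> J b \<omega> = k} \<in> sets M" by measurable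
    then show ?thesis by (simp add: eq_commute)
  qed
  have "{\<omega>\<in>space M. (J a \<omega> = J b \<omega>) = c} \<in> sets M" for a b c
    using eq[of a b] sets.sets_Collect_neg[OF eq[of a b]] by (cases c) simp_all
  then show ?thesis
    unfolding kernel_partition_eq_iff[OF assms(2)]
    by (intro sets.sets_Collect_countable_All sets.sets_Collect_imp sets.sets_Collect_const)
qed

text \<open>Positions with the same index look at the same atom, so their conditions merge into one
  condition with the intersected set. Different blocks look at different atoms, which are
  independent and have law \<open>H\<close>.\<close>

lemma prob_indep_atoms:
  assumes "prob_space M" and Z: "prob_space.indep_vars M (\<lambda>_. borel) Z UNIV"
    and H: "\<And>k. distr M borel (Z k) = H" and A: "\<And>j. j < n \<Longrightarrow> A j \<in> sets borel"
  shows "measure M {\<omega>\<in>space M. \<forall>j<n. Z (i j) \<omega> \<in> A j} =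
    (\<Prod>B\<in>kernel_partition n i. measure H (\<Inter>j\<in>B. A j))"
proof -
  interpret prob_space M by fact
  define K where "K k = {j. j < n \<and> i j = k}" for k :: nat
  \<comment> \<open>The sets are known to be measurable only for positions below \<open>n\<close>;
    the default value keeps \<open>A'\<close> total and measurable.\<close>
  define A' where "A' j = (if j < n then A j else UNIV)" for j
  have A'[measurable]: "A' j \<in> sets borel" for j using A by (auto simp: A'_def)
  have rv[measurable]: "Z k \<in> borel_measurable M" for k
    using Z by (simp add: indep_vars_def)
  have fK: "finite (K k)" for k by (simp add: K_def)
  have mK: "(\<Inter>j\<in>K k. A' j) \<in> sets borel" for k
    using fK[of k] by (cases "K k = {}") (auto intro!: sets.finite_INT)
  have inj: "inj_on K (i ` {..<n})"
    by (auto simp: inj_on_def K_def set_eq_iff)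
  have "(\<forall>j<n. Z (i j) \<omega> \<in> A j) \<longleftrightarrow> (\<forall>k\<in>i ` {..<n}. \<forall>j\<in>K k. Z k \<omega> \<in> A' j)" for \<omega>
    by (auto simp: K_def A'_def)
  \<comment> \<open>For \<open>n = 0\<close> the intersection over no index would be the whole type
    instead of the sample space, and the independence rule asks for a nonempty index set.\<close>
  then have "{\<omega>\<in>space M. \<forall>j<n. Z (i j) \<omega> \<in> A j} =
      (if n = 0 then space M else \<Inter>k\<in>i ` {..<n}. Z k -` (\<Inter>j\<in>K k. A' j) \<inter> space M)"
    by auto
  then have "measure M {\<omega>\<in>space M. \<forall>j<n. Z (i j) \<omega> \<in> A j} =
      prob (if n = 0 then space M else \<Inter>k\<in>i ` {..<n}. Z k -` (\<Inter>j\<in>K k. A' j) \<inter> space M)"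
    by (rule arg_cong)
  also have "\<dots> = (\<Prod>k\<in>i ` {..<n}. prob (Z k -` (\<Inter>j\<in>K k. A' j) \<inter> space M))"
  proof (cases "n = 0")
    case False
    then have "i ` {..<n} \<noteq> {}" by auto
    then have "prob (\<Inter>k\<in>i ` {..<n}. Z k -` (\<Inter>j\<in>K k. A' j) \<inter> space M) =
      (\<Prod>k\<in>i ` {..<n}. prob (Z k -` (\<Inter>j\<in>K k. A' j) \<inter> space M))"
      using mK by (intro indep_varsD[OF Z]) auto
    then show ?thesis using False by simp
  qed (simp add: prob_space)
  also have "\<dots> = (\<Prod>k\<in>i ` {..<n}. measure H (\<Inter>j\<in>K k. A' j))"
  proof (intro prod.cong refl)
    fix k show "prob (Z k -` (\<Inter>j\<in>K k. A' j) \<inter> space M) = measure H (\<Inter>j\<in>K k. A' j)"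
      using H[of k] mK[of k] by (metis measure_distr rv)
  qed
  also have "\<dots> = (\<Prod>B\<in>K ` i ` {..<n}. measure H (\<Inter>j\<in>B. A' j))"
    by (simp add: prod.reindex[OF inj])
  also have "\<dots> = (\<Prod>B\<in>kernel_partition n i. measure H (\<Inter>j\<in>B. A j))"
    unfolding kernel_partition_def by (rule prod.cong) (auto simp: K_def A'_def intro!: arg_cong[where f="measure H"])
  finally show ?thesis .
qed

text \<open>A random index has countably many values, so the map is patched together from countably
  many measurable pieces.\<close>

lemma measurable_apply_index:
  assumes [measurable]: "J \<in> M \<rightarrow>\<^sub>M count_space UNIV" and z: "z \<in> M \<rightarrow>\<^sub>M PiM (UNIV :: nat set) (\<lambda>_. N)"
  shows "(\<lambda>x. z x (J x)) \<in> M \<rightarrow>\<^sub>M N"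
proof (rule measurable_compose_countable[OF _ assms(1)])
  show "(\<lambda>x. z x i) \<in> M \<rightarrow>\<^sub>M N" for i
    using measurable_compose[OF z measurable_component_singleton[of i]] by simp
qed

text \<open>Averages the formula for fixed indices over the law of the index sequence, which is
  legitimate because the indices are independent of the atoms.\<close>

lemma prob_indexed_atoms:
  fixes J :: "nat \<Rightarrow> 'w \<Rightarrow> nat" and Z :: "nat \<Rightarrow> 'w \<Rightarrow> 'x::polish_space"
  assumes "prob_space M" and Z: "prob_space.indep_vars M (\<lambda>_. borel) Z UNIV"
    and H: "\<And>k. distr M borel (Z k) = H" and A: "\<And>j. j < n \<Longrightarrow> A j \<in> sets borel"
    and ind: "indep_rv M (PiM UNIV (\<lambda>_. count_space UNIV)) (\<lambda>\<omega> n. J n \<omega>)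
      (PiM UNIV (\<lambda>_. borel)) (\<lambda>\<omega> j. Z j \<omega>)"
  shows "measure M {\<omega>\<in>space M. \<forall>j<n. Z (J j \<omega>) \<omega> \<in> A j} =
    (\<Sum>\<pi>\<in>partitions n. measure M {\<omega>\<in>space M. kernel_partition n (\<lambda>j. J j \<omega>) = \<pi>} *
       (\<Prod>B\<in>\<pi>. measure H (\<Inter>j\<in>B. A j)))"
proof -
  interpret prob_space M by fact
  let ?I = "PiM UNIV (\<lambda>_. count_space UNIV) :: (nat \<Rightarrow> nat) measure"
  let ?Z = "PiM UNIV (\<lambda>_. borel) :: (nat \<Rightarrow> 'x) measure"
  define h where "h \<pi> = (\<Prod>B\<in>\<pi>. measure H (\<Inter>j\<in>B. A j))" for \<pi>
  have h0: "0 \<le> h \<pi>" for \<pi> by (simp add: h_def prod_nonneg)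
  have Jm: "(\<lambda>\<omega> n. J n \<omega>) \<in> M \<rightarrow>\<^sub>M ?I" and Zm: "(\<lambda>\<omega> j. Z j \<omega>) \<in> M \<rightarrow>\<^sub>M ?Z"
    using ind by (auto simp: indep_rv_def)
  have [measurable]: "J j \<in> M \<rightarrow>\<^sub>M count_space UNIV" "Z j \<in> M \<rightarrow>\<^sub>M borel" for j
    using measurable_compose[OF Jm measurable_component_singleton[of j]]
      measurable_compose[OF Zm measurable_component_singleton[of j]] by auto
  \<comment> \<open>The event as a set of pairs of an index sequence and an atom sequence, the form
    required by Fubini's theorem.\<close>
  define D where "D = {x\<in>space (?I \<Otimes>\<^sub>M ?Z). \<forall>j<n. snd x (fst x j) \<in> A j}"
  have [measurable]: "(\<lambda>x. snd x (fst x j)) \<in> ?I \<Otimes>\<^sub>M ?Z \<rightarrow>\<^sub>M borel" for j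
    by (rule measurable_apply_index) measurable
  have "{x\<in>space (?I \<Otimes>\<^sub>M ?Z). j < n \<longrightarrow> snd x (fst x j) \<in> A j} \<in> sets (?I \<Otimes>\<^sub>M ?Z)" for j
    using A[of j] by (cases "j < n") simp_all
  then have D[measurable]: "D \<in> sets (?I \<Otimes>\<^sub>M ?Z)"
    unfolding D_def by (intro sets.sets_Collect_countable_All)
  have D_iff: "(i, z) \<in> D \<longleftrightarrow> (\<forall>j<n. z (i j) \<in> A j)" for i z
    by (simp add: D_def space_pair_measure space_PiM)
  have K: "{\<omega>\<in>space M. kernel_partition n (\<lambda>j. J j \<omega>) = \<pi>} \<in> events" if "\<pi> \<in> partitions n" for \<pi>
    by (rule sets_kernel_partition[OF _ that]) simp
  have ev: "{\<omega>\<in>space M. \<forall>j<n. Z (i j) \<omega> \<in> A j} \<in> events" for i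
  proof -
    have "{\<omega>\<in>space M. j < n \<longrightarrow> Z (i j) \<omega> \<in> A j} \<in> events" for j
      using A[of j] by (cases "j < n") simp_all
    then show ?thesis by (intro sets.sets_Collect_countable_All)
  qed
  have ev': "{\<omega>\<in>space M. \<forall>j<n. Z (J j \<omega>) \<omega> \<in> A j} \<in> events"
  proof -
    have "(\<lambda>\<omega>. (\<lambda>j. J j \<omega>, \<lambda>j. Z j \<omega>)) -` D \<inter> space M \<in> events"
      by (rule measurable_sets[OF measurable_Pair[OF Jm Zm] D])
    moreover have "(\<lambda>\<omega>. (\<lambda>j. J j \<omega>, \<lambda>j. Z j \<omega>)) -` D \<inter> space M =
        {\<omega>\<in>space M. \<forall>j<n. Z (J j \<omega>) \<omega> \<in> A j}"
      by (auto simp: D_iff)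
    ultimately show ?thesis by (simp only:)
  qed
  have "emeasure M {\<omega>\<in>space M. \<forall>j<n. Z (J j \<omega>) \<omega> \<in> A j} =
      (\<integral>\<^sup>+\<omega>. indicator D (\<lambda>j. J j \<omega>, \<lambda>j. Z j \<omega>) \<partial>M)"
    unfolding nn_integral_indicator[symmetric, OF ev']
    by (rule nn_integral_cong) (simp add: D_iff indicator_def)
  also have "\<dots> = (\<integral>\<^sup>+\<omega>. (\<integral>\<^sup>+\<omega>'. indicator D (\<lambda>j. J j \<omega>, \<lambda>j. Z j \<omega>') \<partial>M) \<partial>M)"
    by (rule nn_integral_indep_rv(1)[OF \<open>prob_space M\<close> ind]) simp
  also have "\<dots> = (\<integral>\<^sup>+\<omega>. emeasure M {\<omega>'\<in>space M. \<forall>j<n. Z (J j \<omega>) \<omega>' \<in> A j} \<partial>M)"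
    unfolding nn_integral_indicator[symmetric, OF ev]
    by (intro nn_integral_cong) (simp add: D_iff indicator_def)
  also have "\<dots> = (\<integral>\<^sup>+\<omega>. ennreal (h (kernel_partition n (\<lambda>j. J j \<omega>))) \<partial>M)"
    by (simp only: emeasure_eq_measure prob_indep_atoms[OF \<open>prob_space M\<close> Z H A] h_def)
  \<comment> \<open>The integrand depends on the indices only through one of finitely many
    partitions, so it is a simple function.\<close>
  also have "\<dots> = (\<integral>\<^sup>+\<omega>. (\<Sum>\<pi>\<in>partitions n. ennreal (h \<pi>) *
      indicator {\<omega>\<in>space M. kernel_partition n (\<lambda>j. J j \<omega>) = \<pi>} \<omega>) \<partial>M)"
  proof (rule nn_integral_cong)
    fix \<omega> assume "\<omega> \<in> space M"
    then have "(\<Sum>\<pi>\<in>partitions n. ennreal (h \<pi>) *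
      indicator {\<omega>\<in>space M. kernel_partition n (\<lambda>j. J j \<omega>) = \<pi>} \<omega>) =
      (\<Sum>\<pi>\<in>partitions n. if kernel_partition n (\<lambda>j. J j \<omega>) = \<pi> then ennreal (h \<pi>) else 0)"
      by (auto intro!: sum.cong)
    then show "ennreal (h (kernel_partition n (\<lambda>j. J j \<omega>))) = (\<Sum>\<pi>\<in>partitions n. ennreal (h \<pi>) *
      indicator {\<omega>\<in>space M. kernel_partition n (\<lambda>j. J j \<omega>) = \<pi>} \<omega>)"
      by (simp add: finite_partitions kernel_partition_in_partitions)
  qed
  also have "\<dots> = (\<Sum>\<pi>\<in>partitions n. ennreal (h \<pi>) *
      emeasure M {\<omega>\<in>space M. kernel_partition n (\<lambda>j. J j \<omega>) = \<pi>})"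
    using K by (subst nn_integral_sum) (auto intro!: sum.cong nn_integral_cmult_indicator)
  also have "\<dots> = ennreal (\<Sum>\<pi>\<in>partitions n. h \<pi> *
      measure M {\<omega>\<in>space M. kernel_partition n (\<lambda>j. J j \<omega>) = \<pi>})"
    by (simp add: emeasure_eq_measure ennreal_mult h0 flip: sum_ennreal)
  finally show ?thesis
    by (simp add: emeasure_eq_measure h_def mult.commute sum_nonneg prod_nonneg)
qed

section \<open>The index of a block\<close>


text \<open>The position of a block in \<open>blocks \<pi>\<close>, obtained by counting: a count is
  easier to follow through a restriction than a sorted list.\<close>

definition block_rank :: "nat set set \<Rightarrow> nat set \<Rightarrow> nat" where
  "block_rank \<pi> B = card {C\<in>\<pi>. Min C < Min B}"

text \<open>The minima increase strictly along the list, so the blocks with a smaller minimum are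
  exactly the earlier entries.\<close>

lemma block_rank_nth_blocks:
  assumes \<pi>: "\<pi> \<in> partitions n" and c: "c < length (blocks \<pi>)"
  shows "block_rank \<pi> (blocks \<pi> ! c) = c"
proof -
  let ?b = "blocks \<pi>"
  have s: "Min (?b ! i) < Min (?b ! j)" if "i < j" "j < length ?b" for i j
    using blocks_partition(4)[OF \<pi>] that by (auto simp: sorted_wrt_iff_nth_less)
  have "{C\<in>\<pi>. Min C < Min (?b ! c)} = (!) ?b ` {..<c}"
  proof (intro set_eqI iffI)
    fix C assume "C \<in> {C\<in>\<pi>. Min C < Min (?b ! c)}"
    then have "C \<in> set ?b" "Min C < Min (?b ! c)" using blocks_partition(1)[OF \<pi>] by auto
    then obtain i where "i < length ?b" "C = ?b ! i" "Min C < Min (?b ! c)"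
      by (metis in_set_conv_nth)
    then show "C \<in> (!) ?b ` {..<c}" using s[of c i] by (cases "i < c"; cases "i = c") auto
  next
    fix C assume "C \<in> (!) ?b ` {..<c}"
    then show "C \<in> {C\<in>\<pi>. Min C < Min (?b ! c)}"
      using s[OF _ c] c blocks_partition(1)[OF \<pi>] nth_mem by fastforce
  qed
  moreover have "inj_on ((!) ?b) {..<c}"
    using blocks_partition(3)[OF \<pi>] c by (auto simp: inj_on_def nth_eq_iff_index_eq)
  ultimately show ?thesis
    unfolding block_rank_def by (simp add: card_image)
qed

lemma blocks_nth_block_rank:
  assumes \<pi>: "\<pi> \<in> partitions n" and B: "B \<in> \<pi>"
  shows "block_rank \<pi> B < length (blocks \<pi>)" "blocks \<pi> ! block_rank \<pi> B = B"
proof -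
  obtain c where c: "c < length (blocks \<pi>)" "B = blocks \<pi> ! c"
    using B blocks_partition(1)[OF \<pi>] by (metis in_set_conv_nth)
  then show "block_rank \<pi> B < length (blocks \<pi>)" "blocks \<pi> ! block_rank \<pi> B = B"
    using block_rank_nth_blocks[OF \<pi>] by auto
qed

text \<open>A block that meets the first \<open>m\<close> positions keeps its minimum under
  restriction. A block that precedes the block of \<open>j\<close> has a minimum below
  \<open>j < m\<close>, so it does meet them: no preceding block is lost and the count is
  unchanged.\<close>

lemma block_rank_restrict_partition:
  assumes \<pi>: "\<pi> \<in> partitions n" and B: "B \<in> \<pi>" "j \<in> B" and j: "j < m"
  shows "block_rank (restrict_partition m \<pi>) (B \<inter> {..<m}) = block_rank \<pi> B"
proof -
  have Min: "Min (C \<inter> {..<m}) = Min C" if C\<pi>: "C \<in> \<pi>" "C \<inter> {..<m} \<noteq> {}" for C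
  proof (rule Min_eqI)
    note C = partitionsD[OF \<pi> that(1)]
    show "finite (C \<inter> {..<m})" by simp
    show "Min C \<le> y" if "y \<in> C \<inter> {..<m}" for y using that C by simp
    obtain y where y: "y \<in> C" "y < m" using C\<pi> by auto
    have "Min C < m" using le_less_trans[OF Min_le[OF C(2) y(1)] y(2)] .
    then show "Min C \<in> C \<inter> {..<m}" using C(2,3) Min_in[of C] by simp
  qed
  have ne: "C \<inter> {..<m} \<noteq> {}" if "C \<in> \<pi>" "Min C < Min B" for C
  proof -
    note C = partitionsD[OF \<pi> that(1)]
    have "Min B \<le> j" using B partitionsD[OF \<pi> B(1)] by simp
    then have "Min C < m" "Min C \<in> C" using that j C by auto
    then show ?thesis by auto
  qed
  have MinB: "Min (B \<inter> {..<m}) = Min B" using Min B j by auto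
  have "{C\<in>restrict_partition m \<pi>. Min C < Min (B \<inter> {..<m})} =
      (\<lambda>C. C \<inter> {..<m}) ` {C\<in>\<pi>. Min C < Min B}"
  proof (intro set_eqI iffI)
    fix D assume "D \<in> {C\<in>restrict_partition m \<pi>. Min C < Min (B \<inter> {..<m})}"
    then obtain C where C: "C \<in> \<pi>" "D = C \<inter> {..<m}" "D \<noteq> {}" "Min D < Min B"
      unfolding restrict_partition_def MinB by blast
    then have "Min C < Min B" using Min[of C] by simp
    then show "D \<in> (\<lambda>C. C \<inter> {..<m}) ` {C\<in>\<pi>. Min C < Min B}" using C by blast
  next
    fix D assume "D \<in> (\<lambda>C. C \<inter> {..<m}) ` {C\<in>\<pi>. Min C < Min B}"
    then obtain C where C: "C \<in> \<pi>" "D = C \<inter> {..<m}" "Min C < Min B" by blast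
    then show "D \<in> {C\<in>restrict_partition m \<pi>. Min C < Min (B \<inter> {..<m})}"
      using Min[OF C(1)] ne[OF C(1,3)] unfolding restrict_partition_def MinB by simp
  qed
  moreover have "inj_on (\<lambda>C. C \<inter> {..<m}) {C\<in>\<pi>. Min C < Min B}"
  proof (rule inj_onI)
    fix C D assume "C \<in> {C\<in>\<pi>. Min C < Min B}" "D \<in> {C\<in>\<pi>. Min C < Min B}"
      and eq: "C \<inter> {..<m} = D \<inter> {..<m}"
    then have CD: "C \<in> \<pi>" "D \<in> \<pi>" "C \<inter> {..<m} \<noteq> {}" using ne by auto
    then obtain y where "y \<in> C" "y \<in> D" using eq by blast
    then show "C = D" using partitionsD(4)[OF \<pi> CD(2,1)] by simp
  qed
  ultimately show ?thesis
    unfolding block_rank_def by (simp add: card_image)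
qed

lemma random_partition_in_partitions:
  assumes "random_partition M P" "\<omega> \<in> space M"
  shows "P n \<omega> \<in> partitions n"
  using assms measurable_space[of "P n" M "count_space (partitions n)" \<omega>]
  by (auto simp: random_partition_def)

lemma block_rank_random_partition:
  assumes P: "random_partition M P" and \<omega>: "\<omega> \<in> space M" and le: "m \<le> n"
    and B: "B \<in> P n \<omega>" "j \<in> B" and C: "C \<in> P m \<omega>" "j \<in> C"
  shows "block_rank (P m \<omega>) C = block_rank (P n \<omega>) B"
proof (cases "m = n")
  case True
  then have "C = B"
    using partitionsD(4)[OF random_partition_in_partitions[OF P \<omega>] B(1) _ B(2) C(2)] C(1) by simp
  then show ?thesis using True by simp
next
  case False
  note part = random_partition_in_partitions[OF P \<omega>]
  have m: "P m \<omega> = restrict_partition m (P n \<omega>)"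
    using P \<omega> False le by (simp add: random_partition_def)
  have j: "j < m" using partitionsD(1)[OF part C(1)] C(2) by auto
  have "B \<inter> {..<m} \<in> P m \<omega>" "j \<in> B \<inter> {..<m}"
    using B j unfolding m restrict_partition_def by auto
  then have "C = B \<inter> {..<m}"
    using partitionsD(4)[OF part _ C(1), of "B \<inter> {..<m}"] C(2) by blast
  then show ?thesis
    using block_rank_restrict_partition[OF part B j] m by simp
qed

text \<open>The definite description in \<open>block_index\<close> ranges over all partitions in the
  sequence at once. It is well defined because the block of \<open>j\<close> has the same rank in
  any two of them that contain \<open>j\<close>.\<close>

lemma block_index_eq_block_rank:
  assumes P: "random_partition M P" and \<omega>: "\<omega> \<in> space M" and B: "B \<in> P n \<omega>" "j \<in> B"
  shows "block_index P j \<omega> = block_rank (P n \<omega>) B"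
  unfolding block_index_def
proof (rule the_equality)
  note part = random_partition_in_partitions[OF P \<omega>]
  have "j < n" using partitionsD(1)[OF part B(1)] B(2) by auto
  then show "\<exists>m>j. block_rank (P n \<omega>) B < length (blocks (P m \<omega>)) \<and>
      j \<in> blocks (P m \<omega>) ! block_rank (P n \<omega>) B"
    using blocks_nth_block_rank[OF part B(1)] B(2) by auto
  fix c assume "\<exists>n>j. c < length (blocks (P n \<omega>)) \<and> j \<in> blocks (P n \<omega>) ! c"
  then obtain m where m: "c < length (blocks (P m \<omega>))" "j \<in> blocks (P m \<omega>) ! c" by auto
  then have C: "blocks (P m \<omega>) ! c \<in> P m \<omega>" using blocks_partition(1)[OF part] nth_mem by blast
  have "block_rank (P m \<omega>) (blocks (P m \<omega>) ! c) = block_rank (P n \<omega>) B"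
    using block_rank_random_partition[OF P \<omega> _ B C m(2)]
      block_rank_random_partition[OF P \<omega> _ C m(2) B] by (cases "m \<le> n") auto
  then show "c = block_rank (P n \<omega>) B"
    using block_rank_nth_blocks[OF part m(1)] by simp
qed
text \<open>Within one partition a block and its rank determine each other, so equal block indices
  mean a common block. Thus the partition induced by the block indices has the law prescribed by the
  EPPF.\<close>

lemma kernel_partition_block_index:
  assumes P: "random_partition M P" and \<omega>: "\<omega> \<in> space M"
  shows "kernel_partition n (\<lambda>j. block_index P j \<omega>) = P n \<omega>"
proof -
  note part = random_partition_in_partitions[OF P \<omega>]
  show ?thesis
    unfolding kernel_partition_eq_iff[OF part]
  proof (intro allI impI)
    fix a b assume "a < n" "b < n"
    then obtain B C where B: "B \<in> P n \<omega>" "a \<in> B" and C: "C \<in> P n \<omega>" "b \<in> C"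
      using partitions_cover[OF part] by metis
    have "block_index P a \<omega> = block_index P b \<omega> \<longleftrightarrow> B = C"
      using block_index_eq_block_rank[OF P \<omega> B] block_index_eq_block_rank[OF P \<omega> C]
        blocks_nth_block_rank(2)[OF part B(1)] blocks_nth_block_rank(2)[OF part C(1)] by metis
    then show "block_index P a \<omega> = block_index P b \<omega> \<longleftrightarrow> (\<exists>B\<in>P n \<omega>. a \<in> B \<and> b \<in> B)"
      using partitionsD(4)[OF part] B C by metis
  qed
qed

lemma indep_rv_block_index:
  assumes "prob_space M" and P: "random_partition M P"
    and ind: "indep_rv M (PiM UNIV (\<lambda>n. count_space (partitions n))) (\<lambda>\<omega> n. P n \<omega>) L Y"
  shows "indep_rv M (PiM UNIV (\<lambda>_. count_space UNIV)) (\<lambda>\<omega> n. block_index P n \<omega>) L Y"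
proof (rule indep_rv_compose_left[OF assms(1) ind])
  \<comment> \<open>The index of \<open>j\<close> is read off the partition number
    \<open>Suc j\<close>, the first whose ground set contains \<open>j\<close>; hence the whole
    sequence of indices is one function of the sequence of partitions. Measurability is automatic on
    the discrete space of partitions.\<close>
  define g where "g j \<pi> = block_rank \<pi> (THE B. B \<in> \<pi> \<and> j \<in> B)" for j \<pi>
  show "(\<lambda>\<pi> j. g j (\<pi> (Suc j))) \<in> PiM UNIV (\<lambda>n. count_space (partitions n)) \<rightarrow>\<^sub>M
      PiM UNIV (\<lambda>_. count_space UNIV)"
  proof (rule measurable_PiM_single')
    fix j :: nat
    have "g j \<in> count_space (partitions (Suc j)) \<rightarrow>\<^sub>M count_space UNIV" by simp
    then show "(\<lambda>\<pi>. g j (\<pi> (Suc j))) \<in> PiM UNIV (\<lambda>n. count_space (partitions n)) \<rightarrow>\<^sub>M count_space UNIV"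
      by (rule measurable_compose[OF measurable_component_singleton[OF UNIV_I]])
  qed auto
  fix \<omega> assume \<omega>: "\<omega> \<in> space M"
  show "(\<lambda>n. block_index P n \<omega>) = (\<lambda>j. g j (P (Suc j) \<omega>))"
  proof
    fix j
    note part = random_partition_in_partitions[OF P \<omega>, of "Suc j"]
    obtain B where B: "B \<in> P (Suc j) \<omega>" "j \<in> B"
      by (rule partitions_cover[OF part lessI])
    then have "(THE B. B \<in> P (Suc j) \<omega> \<and> j \<in> B) = B"
    proof (intro the_equality)
      show "C = B" if "C \<in> P (Suc j) \<omega> \<and> j \<in> C" for C
        using partitionsD(4)[OF part B(1) _ B(2), of C] that by simp
    qed simp
    then show "block_index P j \<omega> = g j (P (Suc j) \<omega>)"
      using block_index_eq_block_rank[OF P \<omega> B] by (simp add: g_def)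
  qed
qed

section \<open>Conditional laws of the indices\<close>


lemma subalgebra_sigma_gen:
  assumes "X \<in> M \<rightarrow>\<^sub>M N"
  shows "subalgebra M (sigma_gen M N X)"
  unfolding subalgebra_def sigma_gen_def
  using measurable_iff_sets[of X M N] assms by auto

lemma measurable_sigma_gen:
  assumes "X \<in> M \<rightarrow>\<^sub>M N"
  shows "X \<in> sigma_gen M N X \<rightarrow>\<^sub>M N"
  unfolding sigma_gen_def using assms by (intro measurable_vimage_algebra1) (auto dest: measurable_space)

lemma sets_sigma_gen:
  assumes "X \<in> M \<rightarrow>\<^sub>M N"
  shows "sets (sigma_gen M N X) = {X -` A \<inter> space M | A. A \<in> sets N}"
  unfolding sigma_gen_def using assms by (intro sets_vimage_algebra2) (auto dest: measurable_space)

text \<open>The mass of \<open>S\<close> under the measure with weights \<open>v\<close>. Summing in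
  \<open>ennreal\<close> makes it defined and measurable without any summability assumption;
  negative entries count as zero.\<close>

definition weight :: "(nat \<Rightarrow> real) \<Rightarrow> nat set \<Rightarrow> real" where
  "weight v S = enn2real (\<Sum>j. ennreal (v j) * indicator S j)"

lemma weight_nonneg: "0 \<le> weight v S"
  by (simp add: weight_def)

lemma weight_singleton: "0 \<le> v j \<Longrightarrow> weight v {j} = v j"
  unfolding weight_def by (subst suminf_finite[of "{j}"]) auto

lemma weight_le_1:
  assumes "(\<Sum>j. ennreal (v j)) = 1"
  shows "weight v S \<le> 1"
proof -
  have "(\<Sum>j. ennreal (v j) * indicator S j) \<le> (\<Sum>j. ennreal (v j))"
    by (intro suminf_le) (auto simp: indicator_def)
  then show ?thesis
    using assms unfolding weight_def by (metis enn2real_leI ennreal_1 zero_le_one)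
qed

lemma measurable_weight [measurable (raw)]:
  assumes [measurable]: "\<And>j. (\<lambda>x. v x j) \<in> borel_measurable M"
  shows "(\<lambda>x. weight (v x) S) \<in> borel_measurable M"
  unfolding weight_def by measurable

text \<open>The weights and the indices, before the atoms enter; \<open>v\<close> stands for the
  sorted weights. The conditional law is given for single indices and is extended to arbitrary sets
  of indices below.\<close>

locale conditional_sampling = prob_space M for M :: "'w measure" +
  fixes v :: "nat \<Rightarrow> 'w \<Rightarrow> real" and I :: "nat \<Rightarrow> 'w \<Rightarrow> nat"
  assumes v_measurable [measurable]: "\<And>k. v k \<in> borel_measurable M"
    and v_nonneg: "AE \<omega> in M. \<forall>k. 0 \<le> v k \<omega>"
    and cond_indep: "cond_indep_seq M (sigma_gen M (PiM UNIV (\<lambda>_. borel)) (\<lambda>\<omega> k. v k \<omega>)) (count_space UNIV) I"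
    and cond_law: "\<And>n j. AE \<omega> in M.
      prob_given M (sigma_gen M (PiM UNIV (\<lambda>_. borel)) (\<lambda>\<omega> k. v k \<omega>)) {\<omega>\<in>space M. I n \<omega> = j} \<omega> = v j \<omega>"
begin

abbreviation G :: "'w measure" where
  "G \<equiv> sigma_gen M (PiM UNIV (\<lambda>_. borel)) (\<lambda>\<omega> k. v k \<omega>)"

lemma I_measurable [measurable]: "I n \<in> M \<rightarrow>\<^sub>M count_space UNIV"
  using cond_indep by (simp add: cond_indep_seq_def)

lemma v_seq_measurable: "(\<lambda>\<omega> k. v k \<omega>) \<in> M \<rightarrow>\<^sub>M PiM UNIV (\<lambda>_. borel)"
  by (intro measurable_PiM_single') auto

sublocale G: finite_measure_subalgebra M G
  by unfold_locales (rule subalgebra_sigma_gen[OF v_seq_measurable])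

lemma v_measurable_G [measurable]: "v k \<in> borel_measurable G"
  using measurable_compose[OF measurable_sigma_gen[OF v_seq_measurable] measurable_component_singleton[of k]]
  by simp

lemma v_integrable: "integrable M (v j)"
proof -
  have "integrable M (real_cond_exp M G (indicator {\<omega>\<in>space M. I 0 \<omega> = j}))"
    by (intro G.real_cond_exp_int integrable_real_indicator) (auto simp: emeasure_eq_measure)
  then show ?thesis
    using cond_law[of 0 j] unfolding prob_given_def by (subst (asm) integrable_cong_AE) auto
qed

text \<open>The defining property of the conditional probability on a set of \<open>G\<close>,
  restated with nonnegative integrals so that it can be summed over \<open>j\<close> without
  integrability conditions.\<close>

lemma emeasure_I_eq:
  assumes B: "B \<in> sets G"
  shows "emeasure M {\<omega>\<in>B. I n \<omega> = j} = (\<integral>\<^sup>+\<omega>. ennreal (v j \<omega>) * indicator B \<omega> \<partial>M)"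
proof -
  have BM: "B \<in> events" using B G.subalg by (auto simp: subalgebra_def)
  have Bs: "B \<subseteq> space M" using sets.sets_into_space[OF BM] .
  have E: "{\<omega>\<in>space M. I n \<omega> = j} \<in> events" by measurable
  have BE: "{\<omega>\<in>B. I n \<omega> = j} = B \<inter> {\<omega>\<in>space M. I n \<omega> = j}" using Bs by auto
  have iB: "integrable M (\<lambda>\<omega>. indicator B \<omega> * v j \<omega>)"
    using integrable_mult_indicator[OF BM v_integrable] by simp
  have "measure M {\<omega>\<in>B. I n \<omega> = j} =
      (\<integral>\<omega>. indicator B \<omega> * indicator {\<omega>\<in>space M. I n \<omega> = j} \<omega> \<partial>M)"
    unfolding BE using BM E by (simp flip: indicator_inter_arith)
  also have "\<dots> = (\<integral>\<omega>. indicator B \<omega> * real_cond_exp M G (indicator {\<omega>\<in>space M. I n \<omega> = j}) \<omega> \<partial>M)"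
    using B BM E by (intro G.real_cond_exp_intg(2)[symmetric])
      (auto simp: emeasure_eq_measure intro!: integrable_real_indicator simp flip: indicator_inter_arith)
  also have "\<dots> = (\<integral>\<omega>. indicator B \<omega> * v j \<omega> \<partial>M)"
    using cond_law[of n j] BM unfolding prob_given_def by (intro integral_cong_AE) auto
  finally have "emeasure M {\<omega>\<in>B. I n \<omega> = j} = ennreal (\<integral>\<omega>. indicator B \<omega> * v j \<omega> \<partial>M)"
    by (simp add: emeasure_eq_measure)
  also have "\<dots> = (\<integral>\<^sup>+\<omega>. ennreal (indicator B \<omega> * v j \<omega>) \<partial>M)"
    using v_nonneg iB by (intro nn_integral_eq_integral[symmetric]) auto
  also have "\<dots> = (\<integral>\<^sup>+\<omega>. ennreal (v j \<omega>) * indicator B \<omega> \<partial>M)"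
    by (intro nn_integral_cong) (auto simp: indicator_def)
  finally show ?thesis .
qed

lemma emeasure_I_in:
  assumes B: "B \<in> sets G"
  shows "emeasure M {\<omega>\<in>B. I n \<omega> \<in> S} = (\<integral>\<^sup>+\<omega>. (\<Sum>j. ennreal (v j \<omega>) * indicator S j) * indicator B \<omega> \<partial>M)"
proof -
  have BM: "B \<in> events" using B G.subalg by (auto simp: subalgebra_def)
  have Bs: "B \<subseteq> space M" using sets.sets_into_space[OF BM] .
  have E: "{\<omega>\<in>B. I n \<omega> = j} \<in> events" for j
  proof -
    have "B \<inter> {\<omega>\<in>space M. I n \<omega> = j} \<in> events" using BM by measurable
    moreover have "B \<inter> {\<omega>\<in>space M. I n \<omega> = j} = {\<omega>\<in>B. I n \<omega> = j}" using Bs by auto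
    ultimately show ?thesis by (simp only:)
  qed
  have "emeasure M {\<omega>\<in>B. I n \<omega> \<in> S} = emeasure M (\<Union>j. if j \<in> S then {\<omega>\<in>B. I n \<omega> = j} else {})"
    by (intro arg_cong[where f="emeasure M"]) (auto split: if_splits)
  also have "\<dots> = (\<Sum>j. emeasure M (if j \<in> S then {\<omega>\<in>B. I n \<omega> = j} else {}))"
    using E by (intro suminf_emeasure[symmetric]) (auto simp: disjoint_family_on_def)
  also have "\<dots> = (\<Sum>j. \<integral>\<^sup>+\<omega>. ennreal (v j \<omega>) * indicator S j * indicator B \<omega> \<partial>M)"
    by (intro suminf_cong) (auto simp: emeasure_I_eq[OF B])
  also have "\<dots> = (\<integral>\<^sup>+\<omega>. (\<Sum>j. ennreal (v j \<omega>) * indicator S j * indicator B \<omega>) \<partial>M)"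
    using BM by (intro nn_integral_suminf[symmetric]) auto
  finally show ?thesis by simp
qed

text \<open>Needed for sets of the form \<open>{j. z j \<in> A}\<close>, where \<open>z\<close> is a
  frozen sequence of atoms. Summing over the indices in \<open>S\<close> after integration over a
  set of \<open>G\<close> avoids handling countably many almost sure identities of conditional
  probabilities.\<close>

lemma prob_given_I_in: "AE \<omega> in M. prob_given M G {\<omega>\<in>space M. I n \<omega> \<in> S} \<omega> = weight (\<lambda>j. v j \<omega>) S"
proof -
  let ?s = "\<lambda>\<omega>. \<Sum>j. ennreal (v j \<omega>) * indicator S j"
  have sp: "space M \<in> sets G" using G.subalg by (metis sets.top subalgebra_def)
  have "(\<integral>\<^sup>+\<omega>. ?s \<omega> \<partial>M) = emeasure M {\<omega>\<in>space M. I n \<omega> \<in> S}"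
    unfolding emeasure_I_in[OF sp] by (intro nn_integral_cong) auto
  then have fin: "(\<integral>\<^sup>+\<omega>. ?s \<omega> \<partial>M) \<noteq> \<infinity>" by (simp add: emeasure_eq_measure)
  \<comment> \<open>\<open>enn2real\<close> would turn an infinite sum into 0; the finite integral
    rules this out almost surely.\<close>
  have AEfin: "AE \<omega> in M. ?s \<omega> \<noteq> \<infinity>"
    by (rule nn_integral_PInf_AE[OF _ fin]) measurable
  have AEeq: "AE \<omega> in M. ennreal (weight (\<lambda>j. v j \<omega>) S) = ?s \<omega>"
    using AEfin by eventually_elim (simp add: weight_def less_top)
  have int: "integrable M (\<lambda>\<omega>. weight (\<lambda>j. v j \<omega>) S)"
  proof (rule integrableI_nonneg)
    have "(\<integral>\<^sup>+\<omega>. ennreal (weight (\<lambda>j. v j \<omega>) S) \<partial>M) = (\<integral>\<^sup>+\<omega>. ?s \<omega> \<partial>M)"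
      by (rule nn_integral_cong_AE[OF AEeq])
    then show "(\<integral>\<^sup>+\<omega>. ennreal (weight (\<lambda>j. v j \<omega>) S) \<partial>M) < \<infinity>" using fin by (simp add: less_top)
  qed (auto simp: weight_nonneg)
  have E: "{\<omega>\<in>space M. I n \<omega> \<in> S} \<in> events" by measurable
  show ?thesis
    unfolding prob_given_def
  proof (rule G.real_cond_exp_charact[OF _ _ int])
    show "integrable M (indicator {\<omega>\<in>space M. I n \<omega> \<in> S} :: _ \<Rightarrow> real)"
      using E by (intro integrable_real_indicator) (auto simp: emeasure_eq_measure)
    fix B assume B: "B \<in> sets G"
    have BM: "B \<in> events" using B G.subalg by (auto simp: subalgebra_def)
    have Bs: "B \<subseteq> space M" using sets.sets_into_space[OF BM] .
    have "(\<integral>\<omega>\<in>B. indicator {\<omega>\<in>space M. I n \<omega> \<in> S} \<omega> \<partial>M) = measure M (B \<inter> {\<omega>\<in>space M. I n \<omega> \<in> S})"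
      unfolding set_lebesgue_integral_def using BM E by (simp flip: indicator_inter_arith)
    also have "B \<inter> {\<omega>\<in>space M. I n \<omega> \<in> S} = {\<omega>\<in>B. I n \<omega> \<in> S}" using Bs by auto
    also have "ennreal (measure M {\<omega>\<in>B. I n \<omega> \<in> S}) =
        (\<integral>\<^sup>+\<omega>. ?s \<omega> * indicator B \<omega> \<partial>M)"
      unfolding emeasure_eq_measure[symmetric] by (rule emeasure_I_in[OF B])
    also have "\<dots> = (\<integral>\<^sup>+\<omega>. ennreal (indicator B \<omega> * weight (\<lambda>j. v j \<omega>) S) \<partial>M)"
      using AEeq by (intro nn_integral_cong_AE, eventually_elim) (auto simp: indicator_def)
    also have "\<dots> = ennreal (\<integral>\<omega>\<in>B. weight (\<lambda>j. v j \<omega>) S \<partial>M)"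
      unfolding set_lebesgue_integral_def using integrable_mult_indicator[OF BM int]
      by (subst nn_integral_eq_integral) (auto simp: weight_nonneg)
    finally show "(\<integral>\<omega>\<in>B. indicator {\<omega>\<in>space M. I n \<omega> \<in> S} \<omega> \<partial>M) = (\<integral>\<omega>\<in>B. weight (\<lambda>j. v j \<omega>) S \<partial>M)"
      by (subst (asm) ennreal_inj) (auto simp: set_lebesgue_integral_def weight_nonneg intro!: integral_nonneg_AE)
  qed measurable
qed

text \<open>An index always takes some value, so the total weight is the conditional probability of
  the sure event.\<close>

lemma v_sum: "AE \<omega> in M. (\<Sum>j. ennreal (v j \<omega>)) = 1"
proof -
  have "AE \<omega> in M. prob_given M G (space M) \<omega> = 1"
  proof -
    have "AE \<omega> in M. real_cond_exp M G (\<lambda>_. 1) \<omega> = 1"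
      by (intro G.real_cond_exp_F_meas) auto
    moreover have "AE \<omega> in M. real_cond_exp M G (indicator (space M)) \<omega> = real_cond_exp M G (\<lambda>_. 1) \<omega>"
      by (intro G.real_cond_exp_cong) auto
    ultimately show ?thesis unfolding prob_given_def by eventually_elim simp
  qed
  moreover have "AE \<omega> in M. prob_given M G (space M) \<omega> = weight (\<lambda>j. v j \<omega>) UNIV"
    using prob_given_I_in[of 0 UNIV] by simp
  ultimately show ?thesis
  proof eventually_elim
    case (elim \<omega>)
    then have "enn2real (\<Sum>j. ennreal (v j \<omega>)) = 1" by (simp add: weight_def)
    then show ?case by (cases "\<Sum>j. ennreal (v j \<omega>)") auto
  qed
qed

lemma prob_given_all_I_in:
  assumes "finite J"
  shows "AE \<omega> in M. prob_given M G {\<omega>\<in>space M. \<forall>i\<in>J. I i \<omega> \<in> S i} \<omega> = (\<Prod>i\<in>J. weight (\<lambda>j. v j \<omega>) (S i))"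
proof -
  have "AE \<omega> in M. prob_given M G {\<omega>\<in>space M. \<forall>i\<in>J. I i \<omega> \<in> S i} \<omega> =
      (\<Prod>i\<in>J. prob_given M G {\<omega>\<in>space M. I i \<omega> \<in> S i} \<omega>)"
    using cond_indep assms by (simp add: cond_indep_seq_def)
  moreover have "AE \<omega> in M. \<forall>i\<in>J. prob_given M G {\<omega>\<in>space M. I i \<omega> \<in> S i} \<omega> = weight (\<lambda>j. v j \<omega>) (S i)"
    using assms prob_given_I_in by (intro AE_finite_allI) auto
  ultimately show ?thesis by eventually_elim (auto intro!: prod.cong)
qed

text \<open>The conditional law tested against a bounded function of the weights. The factor
  \<open>h\<close> will be a constant or \<open>v j\<close> itself in the second moment computation,
  and the indicator of an event about the weights later on; as \<open>v j\<close> is at most 1 only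
  almost surely, so is the bound.\<close>

lemma expectation_all_I_in:
  assumes J: "finite J" and h: "h \<in> borel_measurable G" and b: "AE \<omega> in M. norm (h \<omega>) \<le> (1::real)"
  shows "(\<integral>\<omega>. h \<omega> * indicator {\<omega>\<in>space M. \<forall>i\<in>J. I i \<omega> \<in> S i} \<omega> \<partial>M) =
    (\<integral>\<omega>. h \<omega> * (\<Prod>i\<in>J. weight (\<lambda>j. v j \<omega>) (S i)) \<partial>M)"
proof -
  have E: "{\<omega>\<in>space M. \<forall>i\<in>J. I i \<omega> \<in> S i} \<in> events"
    using J by (intro sets.sets_Collect_finite_All) auto
  have hM: "h \<in> borel_measurable M" using h G.subalg by (rule measurable_from_subalg[rotated])
  have "(\<integral>\<omega>. h \<omega> * indicator {\<omega>\<in>space M. \<forall>i\<in>J. I i \<omega> \<in> S i} \<omega> \<partial>M) =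
      (\<integral>\<omega>. h \<omega> * real_cond_exp M G (indicator {\<omega>\<in>space M. \<forall>i\<in>J. I i \<omega> \<in> S i}) \<omega> \<partial>M)"
  proof (rule G.real_cond_exp_intg(2)[symmetric, OF _ h])
    show "integrable M (\<lambda>\<omega>. h \<omega> * indicator {\<omega>\<in>space M. \<forall>i\<in>J. I i \<omega> \<in> S i} \<omega>)"
      using E hM b by (intro integrable_const_bound[where B=1]) (auto simp: indicator_def elim!: eventually_mono)
  qed (use E in measurable)
  also have "\<dots> = (\<integral>\<omega>. h \<omega> * (\<Prod>i\<in>J. weight (\<lambda>j. v j \<omega>) (S i)) \<partial>M)"
    using prob_given_all_I_in[OF J, of S] hM unfolding prob_given_def
    by (intro integral_cong_AE) auto
  finally show ?thesis .
qed

lemma v_le_1: "AE \<omega> in M. \<forall>k. 0 \<le> v k \<omega> \<and> v k \<omega> \<le> 1"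
  using v_nonneg v_sum
proof eventually_elim
  case (elim \<omega>)
  then show ?case using weight_le_1[of "\<lambda>j. v j \<omega>" "{k}" for k] weight_singleton[of "\<lambda>j. v j \<omega>"] by metis
qed

end

section \<open>Recovering the weights from the indices\<close>


definition proper_weights :: "(nat \<Rightarrow> real) \<Rightarrow> bool" where
  "proper_weights v \<longleftrightarrow> (\<forall>k. 0 \<le> v k) \<and> (\<Sum>k. ennreal (v k)) = 1"

text \<open>No rescaling takes place: an improper vector is replaced by the point mass at 0 and a
  proper one is kept, so that every value is a probability vector.\<close>

definition normalize_weights :: "(nat \<Rightarrow> real) \<Rightarrow> nat \<Rightarrow> real" where
  "normalize_weights v = (if proper_weights v then v else (\<lambda>k. of_bool (k = 0)))"

lemma proper_normalize_weights: "proper_weights (normalize_weights v)"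
proof -
  have "(\<Sum>k. ennreal (of_bool (k = 0))) = (\<Sum>k\<in>{0::nat}. ennreal (of_bool (k = 0)))"
    by (rule suminf_finite) auto
  then have "proper_weights (\<lambda>k. of_bool (k = 0))" by (auto simp: proper_weights_def)
  then show ?thesis by (simp add: normalize_weights_def)
qed

lemma measurable_normalize_weights:
  "normalize_weights \<in> PiM UNIV (\<lambda>_. borel) \<rightarrow>\<^sub>M PiM UNIV (\<lambda>_. borel)"
proof (rule measurable_PiM_single')
  let ?W = "PiM UNIV (\<lambda>_. borel) :: (nat \<Rightarrow> real) measure"
  fix k :: nat
  have comp[measurable]: "(\<lambda>v. v j) \<in> borel_measurable ?W" for j
    by (rule measurable_component_singleton) simp
  have P: "{v\<in>space ?W. proper_weights v} \<in> sets ?W"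
    unfolding proper_weights_def by measurable
  have "(\<lambda>v. if proper_weights v then v k else of_bool (k = 0)) \<in> borel_measurable ?W"
    by (rule measurable_If[OF comp _ P]) (rule measurable_const, simp)
  moreover have "(\<lambda>v. normalize_weights v k) = (\<lambda>v. if proper_weights v then v k else of_bool (k = 0))"
    by (auto simp: normalize_weights_def)
  ultimately show "(\<lambda>v. normalize_weights v k) \<in> borel_measurable ?W" by (simp only:)
qed auto

context conditional_sampling
begin

lemma integrable_AE_bounded:
  fixes f :: "'w \<Rightarrow> real"
  assumes "f \<in> borel_measurable M" "AE \<omega> in M. \<bar>f \<omega>\<bar> \<le> B"
  shows "integrable M f"
  using assms by (intro integrable_const_bound[where B=B]) auto

text \<open>Given the weights, \<open>I a\<close> and \<open>I b\<close> are independent and each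
  hits \<open>j\<close> with probability \<open>v j\<close>. Hence all four terms of the expanded
  product have as expectation, up to sign, the second moment of \<open>v j\<close>, and the signs
  cancel.\<close>

lemma expectation_deviations:
  defines "X j a \<omega> \<equiv> indicator {\<omega>\<in>space M. I a \<omega> = j} \<omega> - v j \<omega>"
  assumes "a \<noteq> b"
  shows "(\<integral>\<omega>. X j a \<omega> * X j b \<omega> \<partial>M) = 0"
proof -
  define e :: "nat \<Rightarrow> 'w \<Rightarrow> real" where "e c = indicator {\<omega>\<in>space M. I c \<omega> = j}" for c
  have [measurable]: "e c \<in> borel_measurable M" for c unfolding e_def by measurable
  have e: "0 \<le> e c \<omega>" "e c \<omega> \<le> 1" for c \<omega> by (auto simp: e_def indicator_def)
  have vj: "AE \<omega> in M. 0 \<le> v j \<omega> \<and> v j \<omega> \<le> 1" using v_le_1 by eventually_elim simp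
  have bound: "AE \<omega> in M. \<bar>f \<omega> * g \<omega>\<bar> \<le> 1" if "AE \<omega> in M. 0 \<le> f \<omega> \<and> f \<omega> \<le> 1" "AE \<omega> in M. 0 \<le> g \<omega> \<and> g \<omega> \<le> 1"
    for f g :: "'w \<Rightarrow> real"
    using that by eventually_elim (simp add: abs_mult mult_le_one)
  have eAE: "AE \<omega> in M. 0 \<le> e c \<omega> \<and> e c \<omega> \<le> 1" for c using e by simp
  have int: "integrable M (\<lambda>\<omega>. e a \<omega> * e b \<omega>)" "integrable M (\<lambda>\<omega>. v j \<omega> * e c \<omega>)"
    "integrable M (\<lambda>\<omega>. v j \<omega> * v j \<omega>)" for c
    by (rule integrable_AE_bounded[OF _ bound[OF eAE eAE]] integrable_AE_bounded[OF _ bound[OF vj eAE]]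
        integrable_AE_bounded[OF _ bound[OF vj vj]]; measurable)+
  have vw: "AE \<omega> in M. weight (\<lambda>j. v j \<omega>) {j} = v j \<omega>"
    using vj by eventually_elim (simp add: weight_singleton)
  have vn: "AE \<omega> in M. norm (v j \<omega>) \<le> 1" using vj by eventually_elim simp
  have ve: "(\<integral>\<omega>. v j \<omega> * e c \<omega> \<partial>M) = (\<integral>\<omega>. v j \<omega> * v j \<omega> \<partial>M)" for c
  proof -
    have "(\<integral>\<omega>. v j \<omega> * indicator {\<omega>\<in>space M. \<forall>i\<in>{c}. I i \<omega> \<in> {j}} \<omega> \<partial>M) =
        (\<integral>\<omega>. v j \<omega> * (\<Prod>i\<in>{c}. weight (\<lambda>j. v j \<omega>) {j}) \<partial>M)"
      by (rule expectation_all_I_in[OF _ v_measurable_G vn]) simp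
    also have "\<dots> = (\<integral>\<omega>. v j \<omega> * v j \<omega> \<partial>M)"
      by (rule integral_cong_AE; measurable?) (use vw in \<open>eventually_elim, simp\<close>)
    finally show ?thesis by (simp add: e_def)
  qed
  have ee: "(\<integral>\<omega>. e a \<omega> * e b \<omega> \<partial>M) = (\<integral>\<omega>. v j \<omega> * v j \<omega> \<partial>M)"
  proof -
    have "(\<integral>\<omega>. e a \<omega> * e b \<omega> \<partial>M) =
        (\<integral>\<omega>. 1 * indicator {\<omega>\<in>space M. \<forall>i\<in>{a, b}. I i \<omega> \<in> {j}} \<omega> \<partial>M)"
      by (intro Bochner_Integration.integral_cong) (auto simp: e_def indicator_def)
    also have "\<dots> = (\<integral>\<omega>. 1 * (\<Prod>i\<in>{a, b}. weight (\<lambda>j. v j \<omega>) {j}) \<partial>M)"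
      by (intro expectation_all_I_in) auto
    also have "\<dots> = (\<integral>\<omega>. v j \<omega> * v j \<omega> \<partial>M)"
      by (rule integral_cong_AE; measurable?) (use vw in \<open>eventually_elim, use \<open>a \<noteq> b\<close> in simp\<close>)
    finally show ?thesis .
  qed
  have "(\<integral>\<omega>. X j a \<omega> * X j b \<omega> \<partial>M) =
      (\<integral>\<omega>. e a \<omega> * e b \<omega> - v j \<omega> * e a \<omega> - v j \<omega> * e b \<omega> + v j \<omega> * v j \<omega> \<partial>M)"
    by (intro Bochner_Integration.integral_cong) (auto simp: X_def e_def algebra_simps)
  also have "\<dots> = 0"
    using int ve ee by simp
  finally show ?thesis .
qed

text \<open>The cross terms vanish, and each of the \<open>n\<close> diagonal terms is at most 1
  because a deviation lies between -1 and 1.\<close>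

lemma expectation_deviation_sum_le:
  defines "X j a \<omega> \<equiv> indicator {\<omega>\<in>space M. I a \<omega> = j} \<omega> - v j \<omega>"
  shows "integrable M (\<lambda>\<omega>. (\<Sum>a<n. X j a \<omega>)\<^sup>2)" (is ?int)
    and "(\<integral>\<omega>. (\<Sum>a<n. X j a \<omega>)\<^sup>2 \<partial>M) \<le> real n" (is ?le)
proof -
  have [measurable]: "X j a \<in> borel_measurable M" for a
    unfolding X_def by measurable
  have X1: "AE \<omega> in M. \<bar>X j a \<omega>\<bar> \<le> 1" for a
    using v_le_1
  proof eventually_elim
    case (elim \<omega>)
    then have "0 \<le> v j \<omega>" "v j \<omega> \<le> 1" by auto
    then show ?case by (auto simp: X_def indicator_def)
  qed
  have XX: "AE \<omega> in M. \<bar>X j a \<omega> * X j b \<omega>\<bar> \<le> 1" for a b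
    using X1[of a] X1[of b] by eventually_elim (simp add: abs_mult mult_le_one)
  have int: "integrable M (\<lambda>\<omega>. X j a \<omega> * X j b \<omega>)" for a b
    by (rule integrable_AE_bounded[OF _ XX]) measurable
  have eq: "(\<Sum>a<n. X j a \<omega>)\<^sup>2 = (\<Sum>a<n. \<Sum>b<n. X j a \<omega> * X j b \<omega>)" for \<omega>
    by (simp add: power2_eq_square sum_product)
  show ?int unfolding eq using int by simp
  have diag: "(\<integral>\<omega>. X j a \<omega> * X j a \<omega> \<partial>M) \<le> 1" for a
  proof -
    have "(\<integral>\<omega>. X j a \<omega> * X j a \<omega> \<partial>M) \<le> (\<integral>\<omega>. 1 \<partial>M)"
      using XX[of a a] by (intro integral_mono_AE int) auto
    then show ?thesis by (simp add: prob_space)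
  qed
  have "(\<integral>\<omega>. (\<Sum>a<n. X j a \<omega>)\<^sup>2 \<partial>M) = (\<Sum>a<n. \<Sum>b<n. \<integral>\<omega>. X j a \<omega> * X j b \<omega> \<partial>M)"
    unfolding eq using int by simp
  also have "\<dots> = (\<Sum>a<n. \<Sum>b<n. if a = b then \<integral>\<omega>. X j a \<omega> * X j a \<omega> \<partial>M else 0)"
    using expectation_deviations unfolding X_def by (intro sum.cong refl) auto
  also have "\<dots> = (\<Sum>a<n. \<integral>\<omega>. X j a \<omega> * X j a \<omega> \<partial>M)" by simp
  also have "\<dots> \<le> (\<Sum>a<n. 1)" using diag by (intro sum_mono)
  finally show ?le by simp
qed

text \<open>A weak law of large numbers suffices here: the squared error of the frequency tends to 0
  in mean, hence almost surely along a subsequence. The subsequence is not random, so the limit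
  along it is still a function of the indices.\<close>

lemma frequency_tendsto:
  "\<exists>r :: nat \<Rightarrow> nat. AE \<omega> in M.
     (\<lambda>n. (\<Sum>a<Suc (r n). of_bool (I a \<omega> = j)) / real (Suc (r n))) \<longlonglongrightarrow> v j \<omega>"
proof -
  define X where "X a \<omega> = indicator {\<omega>\<in>space M. I a \<omega> = j} \<omega> - v j \<omega>" for a \<omega>
  \<comment> \<open>The squared error of the frequency among the first \<open>Suc n\<close> indices;
    the successor avoids division by zero. By the second moment bound its mean is at most
    \<open>1 / real (Suc n)\<close>.\<close>
  define u where "u n \<omega> = (\<Sum>a<Suc n. X a \<omega>)\<^sup>2 / (real (Suc n))\<^sup>2" for n \<omega>
  note dev = expectation_deviation_sum_le[of j "Suc n" for n, folded X_def]
  have int: "integrable M (u n)" for n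
    unfolding u_def using dev(1)[of n] by (rule integrable_divide)
  have u0: "0 \<le> u n \<omega>" for n \<omega> by (simp add: u_def)
  have le: "(\<integral>\<omega>. norm (u n \<omega>) \<partial>M) \<le> 1 / real (Suc n)" for n
  proof -
    have "(\<integral>\<omega>. norm (u n \<omega>) \<partial>M) = (\<integral>\<omega>. (\<Sum>a<Suc n. X a \<omega>)\<^sup>2 \<partial>M) / (real (Suc n))\<^sup>2"
      unfolding real_norm_def abs_of_nonneg[OF u0] unfolding u_def by (rule integral_divide_zero)
    also have "\<dots> \<le> real (Suc n) / (real (Suc n))\<^sup>2"
      by (intro divide_right_mono dev(2)) simp
    finally show ?thesis by (simp add: power2_eq_square)
  qed
  have "(\<lambda>n. \<integral>\<omega>. norm (u n \<omega>) \<partial>M) \<longlonglongrightarrow> 0"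
    by (rule tendsto_sandwich[OF _ _ tendsto_const LIMSEQ_inverse_real_of_nat])
       (use le in \<open>auto simp: inverse_eq_divide\<close>)
  from tendsto_L1_AE_subseq[OF int this] obtain r where r: "AE \<omega> in M. (\<lambda>n. u (r n) \<omega>) \<longlonglongrightarrow> 0"
    by blast
  show ?thesis
  proof (intro exI[of _ r])
    show "AE \<omega> in M. (\<lambda>n. (\<Sum>a<Suc (r n). of_bool (I a \<omega> = j)) / real (Suc (r n))) \<longlonglongrightarrow> v j \<omega>"
      using r AE_space
    proof eventually_elim
      case (elim \<omega>)
      define f where "f n = (\<Sum>a<Suc (r n). of_bool (I a \<omega> = j)) / real (Suc (r n))" for n
      have "u (r n) \<omega> = (f n - v j \<omega>)\<^sup>2" for n
      proof -
        have "(\<Sum>a<Suc (r n). X a \<omega>) = (\<Sum>a<Suc (r n). of_bool (I a \<omega> = j)) - real (Suc (r n)) * v j \<omega>"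
          using elim(2) by (simp add: X_def sum_subtractf of_bool_def indicator_def)
        then have "(\<Sum>a<Suc (r n). X a \<omega>) / real (Suc (r n)) = f n - v j \<omega>"
          by (simp add: f_def diff_divide_distrib del: sum.lessThan_Suc of_nat_Suc)
        then show ?thesis by (simp add: u_def flip: power_divide)
      qed
      with elim(1) have "(\<lambda>n. sqrt ((f n - v j \<omega>)\<^sup>2)) \<longlonglongrightarrow> sqrt 0"
        by (intro tendsto_real_sqrt) simp
      then have "(\<lambda>n. f n - v j \<omega>) \<longlonglongrightarrow> 0"
        by (simp add: tendsto_rabs_zero_iff)
      then show ?case unfolding f_def by (rule LIM_zero_cancel)
    qed
  qed
qed

text \<open>Each \<open>j\<close> has its own subsequence, chosen once and for all; as there are
  countably many \<open>j\<close>, the limits hold simultaneously outside one null set.\<close>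

lemma weights_of_indices:
  obtains F where "F \<in> PiM UNIV (\<lambda>_. count_space UNIV) \<rightarrow>\<^sub>M PiM UNIV (\<lambda>_. borel)"
    and "\<And>i. proper_weights (F i)"
    and "AE \<omega> in M. F (\<lambda>n. I n \<omega>) = (\<lambda>k. v k \<omega>)"
proof -
  let ?I = "PiM UNIV (\<lambda>_. count_space UNIV) :: (nat \<Rightarrow> nat) measure"
  have "\<forall>j. \<exists>r :: nat \<Rightarrow> nat. AE \<omega> in M.
     (\<lambda>n. (\<Sum>a<Suc (r n). of_bool (I a \<omega> = j)) / real (Suc (r n))) \<longlonglongrightarrow> v j \<omega>"
    using frequency_tendsto by blast
  from choice[OF this] obtain r :: "nat \<Rightarrow> nat \<Rightarrow> nat" where r: "\<forall>j. AE \<omega> in M.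
     (\<lambda>n. (\<Sum>a<Suc (r j n). of_bool (I a \<omega> = j)) / real (Suc (r j n))) \<longlonglongrightarrow> v j \<omega>"
 ..
  define L where "L i j = lim (\<lambda>n. (\<Sum>a<Suc (r j n). of_bool (i a = j)) / real (Suc (r j n)))"
    for i :: "nat \<Rightarrow> nat" and j
  \<comment> \<open>\<open>lim\<close> returns some value even where the frequencies diverge;
    normalizing makes the result a probability vector on every index sequence.\<close>
  define F where "F i = normalize_weights (L i)" for i
  have ob[measurable]: "(\<lambda>i. of_bool (i a = j) :: real) \<in> borel_measurable ?I" for a j
  proof -
    have "(\<lambda>i. i a) \<in> ?I \<rightarrow>\<^sub>M count_space UNIV" by (rule measurable_component_singleton) simp
    then show ?thesis by (rule measurable_compose) simp
  qed
  have L[measurable]: "(\<lambda>i. L i j) \<in> borel_measurable ?I" for j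
    unfolding L_def by measurable
  have "L \<in> ?I \<rightarrow>\<^sub>M PiM UNIV (\<lambda>_. borel)"
    by (rule measurable_PiM_single') (use L in auto)
  then have "F \<in> ?I \<rightarrow>\<^sub>M PiM UNIV (\<lambda>_. borel)"
    unfolding F_def by (rule measurable_compose[OF _ measurable_normalize_weights])
  moreover have "proper_weights (F i)" for i
    unfolding F_def by (rule proper_normalize_weights)
  moreover have "AE \<omega> in M. F (\<lambda>n. I n \<omega>) = (\<lambda>k. v k \<omega>)"
  proof -
    have "AE \<omega> in M. \<forall>j. L (\<lambda>n. I n \<omega>) j = v j \<omega>"
      unfolding AE_all_countable
    proof
      fix j show "AE \<omega> in M. L (\<lambda>n. I n \<omega>) j = v j \<omega>"
        using r[rule_format, of j] by eventually_elim (auto simp only: L_def intro!: limI)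
    qed
    then show ?thesis
      using v_nonneg v_sum
    proof eventually_elim
      case (elim \<omega>)
      then have "L (\<lambda>n. I n \<omega>) = (\<lambda>k. v k \<omega>)" by auto
      then show ?case using elim(2,3) by (simp add: F_def normalize_weights_def proper_weights_def)
    qed
  qed
  ultimately show thesis by (rule that)
qed

text \<open>The conditional law with \<open>v\<close> replaced by its reconstruction from the
  indices. Both integrands now depend on the index sequence alone, which is the variable known to be
  independent of the atoms.\<close>

lemma nn_integral_I_in_weights:
  assumes F: "F \<in> PiM UNIV (\<lambda>_. count_space UNIV) \<rightarrow>\<^sub>M PiM UNIV (\<lambda>_. borel)"
    and FI: "AE \<omega> in M. F (\<lambda>n. I n \<omega>) = (\<lambda>k. v k \<omega>)"
    and J: "finite J" and B: "B \<in> sets (PiM UNIV (\<lambda>_. borel))"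
  shows "(\<integral>\<^sup>+\<omega>. indicator B (F (\<lambda>n. I n \<omega>)) * indicator {\<omega>\<in>space M. \<forall>i\<in>J. I i \<omega> \<in> S i} \<omega> \<partial>M) =
    (\<integral>\<^sup>+\<omega>. indicator B (F (\<lambda>n. I n \<omega>)) * ennreal (\<Prod>i\<in>J. weight (F (\<lambda>n. I n \<omega>)) (S i)) \<partial>M)"
proof -
  let ?E = "{\<omega>\<in>space M. \<forall>i\<in>J. I i \<omega> \<in> S i}"
  define h :: "'w \<Rightarrow> real" where "h \<omega> = indicator B (\<lambda>k. v k \<omega>)" for \<omega>
  have hG: "h \<in> borel_measurable G"
    unfolding h_def
    by (rule measurable_compose[OF measurable_sigma_gen[OF v_seq_measurable]]) (use B in measurable)
  have hM[measurable]: "h \<in> borel_measurable M" using hG G.subalg by (rule measurable_from_subalg[rotated])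
  have h: "0 \<le> h \<omega>" "h \<omega> \<le> 1" for \<omega> by (auto simp: h_def)
  have E[measurable]: "?E \<in> events"
    using J by (intro sets.sets_Collect_finite_All) auto
  have W0: "0 \<le> (\<Prod>i\<in>J. weight (\<lambda>k. v k \<omega>) (S i))" for \<omega> by (intro prod_nonneg) (simp add: weight_nonneg)
  have W1: "AE \<omega> in M. (\<Prod>i\<in>J. weight (\<lambda>k. v k \<omega>) (S i)) \<le> 1"
    using v_sum by eventually_elim (auto intro!: prod_le_1 simp: weight_nonneg weight_le_1)
  have "(\<integral>\<^sup>+\<omega>. indicator B (F (\<lambda>n. I n \<omega>)) * indicator ?E \<omega> \<partial>M) =
      (\<integral>\<^sup>+\<omega>. ennreal (h \<omega> * indicator ?E \<omega>) \<partial>M)"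
    using FI by (intro nn_integral_cong_AE, eventually_elim) (simp add: h_def indicator_def)
  also have "\<dots> = ennreal (\<integral>\<omega>. h \<omega> * indicator ?E \<omega> \<partial>M)"
    using h by (intro nn_integral_eq_integral integrable_AE_bounded[where B=1]) (auto simp: indicator_def)
  also have "\<dots> = ennreal (\<integral>\<omega>. h \<omega> * (\<Prod>i\<in>J. weight (\<lambda>k. v k \<omega>) (S i)) \<partial>M)"
    using h by (subst expectation_all_I_in[OF J hG]) auto
  also have "\<dots> = (\<integral>\<^sup>+\<omega>. ennreal (h \<omega> * (\<Prod>i\<in>J. weight (\<lambda>k. v k \<omega>) (S i))) \<partial>M)"
  proof (rule nn_integral_eq_integral[symmetric])
    show "integrable M (\<lambda>\<omega>. h \<omega> * (\<Prod>i\<in>J. weight (\<lambda>k. v k \<omega>) (S i)))"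
    proof (rule integrable_AE_bounded[where B=1])
      show "AE \<omega> in M. \<bar>h \<omega> * (\<Prod>i\<in>J. weight (\<lambda>k. v k \<omega>) (S i))\<bar> \<le> 1"
        using W1 by eventually_elim (use h W0 in \<open>simp add: abs_mult mult_le_one\<close>)
    qed measurable
  qed (use h W0 in auto)
  also have "\<dots> = (\<integral>\<^sup>+\<omega>. indicator B (F (\<lambda>n. I n \<omega>)) *
      ennreal (\<Prod>i\<in>J. weight (F (\<lambda>n. I n \<omega>)) (S i)) \<partial>M)"
    using FI by (intro nn_integral_cong_AE, eventually_elim) (simp add: h_def indicator_def)
  finally show ?thesis .
qed

end

section \<open>The directing random measure\<close>


lemma space_discrete_measure [simp]: "space (discrete_measure v z) = UNIV"
  by (metis sets_discrete_measure sets_eq_imp_space_eq space_borel)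

lemma measure_discrete_measure:
  assumes "A \<in> sets borel"
  shows "measure (discrete_measure v z) A = weight v {j. z j \<in> A}"
  unfolding measure_def emeasure_discrete_measure[OF assms] weight_def by (simp add: indicator_def)

lemma prob_space_discrete_measure:
  assumes "proper_weights v"
  shows "prob_space (discrete_measure v z)"
proof (rule prob_spaceI)
  show "emeasure (discrete_measure v z) (space (discrete_measure v z)) = 1"
    using assms emeasure_discrete_measure[of UNIV v z] by (simp add: proper_weights_def)
qed

lemma measurable_discrete_measure:
  fixes z :: "'a \<Rightarrow> nat \<Rightarrow> 'x::polish_space"
  assumes v: "v \<in> M \<rightarrow>\<^sub>M PiM UNIV (\<lambda>_. borel)" and z: "z \<in> M \<rightarrow>\<^sub>M PiM UNIV (\<lambda>_. borel)"
    and proper: "\<And>x. proper_weights (v x)"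
  shows "(\<lambda>x. discrete_measure (v x) (z x)) \<in> M \<rightarrow>\<^sub>M prob_algebra borel"
proof (rule measurable_prob_algebraI)
  have [measurable]: "(\<lambda>x. v x j) \<in> borel_measurable M" "(\<lambda>x. z x j) \<in> borel_measurable M" for j
    using measurable_compose[OF v measurable_component_singleton[of j]]
      measurable_compose[OF z measurable_component_singleton[of j]] by simp_all
  show "prob_space (discrete_measure (v x) (z x))" for x
    using proper by (rule prob_space_discrete_measure)
  show "(\<lambda>x. discrete_measure (v x) (z x)) \<in> M \<rightarrow>\<^sub>M subprob_algebra borel"
  proof (rule measurable_subprob_algebra)
    show "subprob_space (discrete_measure (v x) (z x))" for x
      using prob_space_discrete_measure[OF proper] by (rule prob_space_imp_subprob_space)
    fix A :: "'x set" assume A[measurable]: "A \<in> sets borel"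
    show "(\<lambda>x. emeasure (discrete_measure (v x) (z x)) A) \<in> borel_measurable M"
      unfolding emeasure_discrete_measure[OF A] by measurable
  qed simp
qed

lemma measurable_measure_prob_algebra:
  assumes "p \<in> M \<rightarrow>\<^sub>M prob_algebra N" "A \<in> sets N"
  shows "(\<lambda>x. measure (p x) A) \<in> borel_measurable M"
  using measurable_compose[OF measurable_prob_algebraD[OF assms(1)] measurable_measure_subprob_algebra[OF assms(2)]] .

text \<open>\<open>F\<close> is the reconstruction provided by \<open>weights_of_indices\<close>.
  Having it as a parameter allows the directing measure to be defined from it.\<close>

locale species_sampling_sequence = conditional_sampling M v I
  for M :: "'w measure" and v :: "nat \<Rightarrow> 'w \<Rightarrow> real" and I :: "nat \<Rightarrow> 'w \<Rightarrow> nat" +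
  fixes Z :: "nat \<Rightarrow> 'w \<Rightarrow> 'x::polish_space" and F :: "(nat \<Rightarrow> nat) \<Rightarrow> nat \<Rightarrow> real"
  assumes I_Z_indep: "indep_rv M (PiM UNIV (\<lambda>_. count_space UNIV)) (\<lambda>\<omega> n. I n \<omega>)
      (PiM UNIV (\<lambda>_. borel)) (\<lambda>\<omega> j. Z j \<omega>)"
    and F_measurable: "F \<in> PiM UNIV (\<lambda>_. count_space UNIV) \<rightarrow>\<^sub>M PiM UNIV (\<lambda>_. borel)"
    and F_proper: "\<And>i. proper_weights (F i)"
    and F_I: "AE \<omega> in M. F (\<lambda>n. I n \<omega>) = (\<lambda>k. v k \<omega>)"
begin

text \<open>A version of the sorted weights that is a function of the indices and a probability
  vector at every sample point.\<close>

definition V :: "'w \<Rightarrow> nat \<Rightarrow> real" where "V \<omega> = F (\<lambda>n. I n \<omega>)"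

definition p :: "'w \<Rightarrow> 'x measure" where "p \<omega> = discrete_measure (V \<omega>) (\<lambda>j. Z j \<omega>)"

lemma I_seq_measurable: "(\<lambda>\<omega> n. I n \<omega>) \<in> M \<rightarrow>\<^sub>M PiM UNIV (\<lambda>_. count_space UNIV)"
  and Z_seq_measurable: "(\<lambda>\<omega> j. Z j \<omega>) \<in> M \<rightarrow>\<^sub>M PiM UNIV (\<lambda>_. borel)"
  using I_Z_indep by (auto simp: indep_rv_def)

lemma V_measurable: "V \<in> M \<rightarrow>\<^sub>M PiM UNIV (\<lambda>_. borel)"
  unfolding V_def by (rule measurable_compose[OF I_seq_measurable F_measurable])

lemma Z_measurable [measurable]: "Z j \<in> borel_measurable M"
  using measurable_compose[OF Z_seq_measurable measurable_component_singleton[of j]] by simp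

lemma atom_measurable [measurable]: "(\<lambda>\<omega>. Z (I n \<omega>) \<omega>) \<in> borel_measurable M"
  by (rule measurable_apply_index[OF I_measurable Z_seq_measurable])

lemma V_proper: "proper_weights (V \<omega>)"
  unfolding V_def by (rule F_proper)

lemma p_measurable: "p \<in> M \<rightarrow>\<^sub>M prob_algebra borel"
  unfolding p_def by (rule measurable_discrete_measure[OF V_measurable Z_seq_measurable V_proper])

lemma p_prob: "prob_space (p \<omega>)"
  unfolding p_def by (rule prob_space_discrete_measure[OF V_proper])

text \<open>With the atoms frozen at \<open>z\<close>, membership of the directing measure in
  \<open>B\<close> is an event about the weights, and the condition on position \<open>i\<close>
  says that \<open>I i\<close> lies in \<open>{j. z j \<in> A i}\<close>. The conditional law of the
  indices replaces the latter conditions by the product of the masses of these sets, which are the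
  masses of the \<open>A i\<close> under the directing measure.\<close>

lemma joint_law:
  assumes J: "finite J" and A: "\<And>i. i \<in> J \<Longrightarrow> A i \<in> sets borel" and B: "B \<in> sets (prob_algebra borel)"
  shows "emeasure M {\<omega>\<in>space M. p \<omega> \<in> B \<and> (\<forall>i\<in>J. Z (I i \<omega>) \<omega> \<in> A i)} =
    (\<integral>\<^sup>+\<omega>. indicator B (p \<omega>) * ennreal (\<Prod>i\<in>J. measure (p \<omega>) (A i)) \<partial>M)"
proof -
  let ?I = "PiM UNIV (\<lambda>_. count_space UNIV) :: (nat \<Rightarrow> nat) measure"
  let ?Z = "PiM UNIV (\<lambda>_. borel) :: (nat \<Rightarrow> 'x) measure"
  let ?D = "\<lambda>x. discrete_measure (F (fst x)) (snd x)"
  define f :: "(nat \<Rightarrow> nat) \<times> (nat \<Rightarrow> 'x) \<Rightarrow> ennreal" where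
    "f x = indicator B (?D x) * (\<Prod>i\<in>J. indicator (A i) (snd x (fst x i)))" for x
  define g :: "(nat \<Rightarrow> nat) \<times> (nat \<Rightarrow> 'x) \<Rightarrow> ennreal" where
    "g x = indicator B (?D x) * ennreal (\<Prod>i\<in>J. measure (?D x) (A i))" for x
  have D: "?D \<in> ?I \<Otimes>\<^sub>M ?Z \<rightarrow>\<^sub>M prob_algebra borel"
    by (rule measurable_discrete_measure[OF measurable_compose[OF measurable_fst F_measurable] measurable_snd F_proper])
  have iD: "(\<lambda>x. indicator B (?D x) :: ennreal) \<in> borel_measurable (?I \<Otimes>\<^sub>M ?Z)"
    by (rule measurable_compose[OF D]) (use B in simp)
  have "(\<lambda>x. indicator (A i) (snd x (fst x i)) :: ennreal) \<in> borel_measurable (?I \<Otimes>\<^sub>M ?Z)" if "i \<in> J" for i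
  proof -
    have "(\<lambda>x. snd x (fst x i)) \<in> ?I \<Otimes>\<^sub>M ?Z \<rightarrow>\<^sub>M borel"
      by (rule measurable_apply_index) measurable
    then show ?thesis
      by (rule measurable_compose) (use A[OF that] in simp)
  qed
  then have f: "f \<in> borel_measurable (?I \<Otimes>\<^sub>M ?Z)"
    unfolding f_def by (intro borel_measurable_times_ennreal iD borel_measurable_prod_ennreal)
  have "(\<lambda>x. \<Prod>i\<in>J. measure (?D x) (A i)) \<in> borel_measurable (?I \<Otimes>\<^sub>M ?Z)"
    by (intro borel_measurable_prod measurable_measure_prob_algebra[OF D] A)
  from measurable_compose[OF this measurable_ennreal]
  have g: "g \<in> borel_measurable (?I \<Otimes>\<^sub>M ?Z)"
    unfolding g_def by (intro borel_measurable_times_ennreal iD)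
  have fin: "(\<Prod>i\<in>J. indicator (A i) (x i)) = (if \<forall>i\<in>J. x i \<in> A i then 1 else 0 :: ennreal)" for x
    using J by (induction J rule: finite_induct) (auto simp: indicator_def)
  have inner: "(\<integral>\<^sup>+\<omega>. f (\<lambda>n. I n \<omega>, z) \<partial>M) = (\<integral>\<^sup>+\<omega>. g (\<lambda>n. I n \<omega>, z) \<partial>M)" for z
  proof -
    \<comment> \<open>\<open>normalize_weights\<close> makes the measure a probability for all
      weight vectors, so that \<open>B'\<close> is measurable; values of \<open>F\<close> are left
      as they are.\<close>
    define B' where "B' = {w. discrete_measure (normalize_weights w) z \<in> B}"
    have "(\<lambda>w. discrete_measure (normalize_weights w) z) \<in> PiM UNIV (\<lambda>_. borel) \<rightarrow>\<^sub>M prob_algebra borel"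
      by (rule measurable_discrete_measure[OF measurable_normalize_weights _ proper_normalize_weights])
        (simp add: space_PiM)
    from measurable_sets[OF this B] have B': "B' \<in> sets (PiM UNIV (\<lambda>_. borel))"
      by (simp add: B'_def vimage_def space_PiM)
    have norm: "normalize_weights (F i) = F i" for i
      using F_proper by (simp add: normalize_weights_def)
    have "(\<integral>\<^sup>+\<omega>. f (\<lambda>n. I n \<omega>, z) \<partial>M) = (\<integral>\<^sup>+\<omega>. indicator B' (F (\<lambda>n. I n \<omega>)) *
        indicator {\<omega>\<in>space M. \<forall>i\<in>J. I i \<omega> \<in> {j. z j \<in> A i}} \<omega> \<partial>M)"
      by (rule nn_integral_cong) (simp add: f_def fin J B'_def norm indicator_def)
    also have "\<dots> = (\<integral>\<^sup>+\<omega>. indicator B' (F (\<lambda>n. I n \<omega>)) *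
        ennreal (\<Prod>i\<in>J. weight (F (\<lambda>n. I n \<omega>)) {j. z j \<in> A i}) \<partial>M)"
      by (rule nn_integral_I_in_weights[OF F_measurable F_I J B'])
    also have "\<dots> = (\<integral>\<^sup>+\<omega>. g (\<lambda>n. I n \<omega>, z) \<partial>M)"
      by (rule nn_integral_cong) (simp add: g_def B'_def norm indicator_def measure_discrete_measure[OF A] cong: prod.cong)
    finally show ?thesis .
  qed
  have E1: "{\<omega>\<in>space M. \<forall>i\<in>J. Z (I i \<omega>) \<omega> \<in> A i} \<in> events"
    using J A by (intro sets.sets_Collect_finite_All) (auto intro: measurable_sets_Collect[OF atom_measurable])
  have E2: "{\<omega>\<in>space M. p \<omega> \<in> B} \<in> events"
    using measurable_sets[OF p_measurable B] by (simp add: vimage_def Int_def conj_commute)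
  have "{\<omega>\<in>space M. p \<omega> \<in> B \<and> (\<forall>i\<in>J. Z (I i \<omega>) \<omega> \<in> A i)} \<in> events"
    by (intro sets.sets_Collect_conj E1 E2)
  note nn_integral_indicator[symmetric, OF this]
  also have "(\<integral>\<^sup>+\<omega>. indicator {\<omega>\<in>space M. p \<omega> \<in> B \<and> (\<forall>i\<in>J. Z (I i \<omega>) \<omega> \<in> A i)} \<omega> \<partial>M) =
      (\<integral>\<^sup>+\<omega>. f (\<lambda>n. I n \<omega>, \<lambda>j. Z j \<omega>) \<partial>M)"
    by (rule nn_integral_cong) (simp add: f_def fin J p_def V_def indicator_def)
  also have "\<dots> = (\<integral>\<^sup>+\<omega>'. (\<integral>\<^sup>+\<omega>. f (\<lambda>n. I n \<omega>, \<lambda>j. Z j \<omega>') \<partial>M) \<partial>M)"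
    by (rule nn_integral_indep_rv(2)[OF prob_space_axioms I_Z_indep f])
  also have "\<dots> = (\<integral>\<^sup>+\<omega>'. (\<integral>\<^sup>+\<omega>. g (\<lambda>n. I n \<omega>, \<lambda>j. Z j \<omega>') \<partial>M) \<partial>M)"
    unfolding inner ..
  also have "\<dots> = (\<integral>\<^sup>+\<omega>. g (\<lambda>n. I n \<omega>, \<lambda>j. Z j \<omega>) \<partial>M)"
    by (rule nn_integral_indep_rv(2)[OF prob_space_axioms I_Z_indep g, symmetric])
  also have "\<dots> = (\<integral>\<^sup>+\<omega>. indicator B (p \<omega>) * ennreal (\<Prod>i\<in>J. measure (p \<omega>) (A i)) \<partial>M)"
    by (rule nn_integral_cong) (simp add: g_def p_def V_def)
  finally show ?thesis .
qed

text \<open>The sigma-algebra of \<open>p\<close> consists of the events that \<open>p\<close> lies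
  in some \<open>B\<close>, and on each of them \<open>joint_law\<close> compares the two
  integrals.\<close>

lemma prob_given_atoms:
  assumes J: "finite J" and A: "\<And>i. i \<in> J \<Longrightarrow> A i \<in> sets borel"
  shows "AE \<omega> in M. prob_given M (sigma_gen M (prob_algebra borel) p)
      {\<omega>\<in>space M. \<forall>i\<in>J. Z (I i \<omega>) \<omega> \<in> A i} \<omega> = (\<Prod>i\<in>J. measure (p \<omega>) (A i))"
proof -
  let ?F = "sigma_gen M (prob_algebra borel) p"
  let ?E = "{\<omega>\<in>space M. \<forall>i\<in>J. Z (I i \<omega>) \<omega> \<in> A i}"
  interpret S: finite_measure_subalgebra M ?F
    by unfold_locales (rule subalgebra_sigma_gen[OF p_measurable])
  have E: "?E \<in> events"
    using J A by (intro sets.sets_Collect_finite_All) (auto intro: measurable_sets_Collect[OF atom_measurable])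
  have WF: "(\<lambda>\<omega>. \<Prod>i\<in>J. measure (p \<omega>) (A i)) \<in> borel_measurable ?F"
    by (intro borel_measurable_prod measurable_measure_prob_algebra[OF measurable_sigma_gen[OF p_measurable]] A)
  have WM: "(\<lambda>\<omega>. \<Prod>i\<in>J. measure (p \<omega>) (A i)) \<in> borel_measurable M"
    by (intro borel_measurable_prod measurable_measure_prob_algebra[OF p_measurable] A)
  have W0: "0 \<le> (\<Prod>i\<in>J. measure (p \<omega>) (A i))" for \<omega> by (intro prod_nonneg) simp
  have W1: "(\<Prod>i\<in>J. measure (p \<omega>) (A i)) \<le> 1" for \<omega>
    by (intro prod_le_1) (simp add: prob_space.prob_le_1[OF p_prob])
  have int: "integrable M (\<lambda>\<omega>. \<Prod>i\<in>J. measure (p \<omega>) (A i))"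
    using W0 W1 by (intro integrable_AE_bounded[OF WM, where B=1]) simp
  show ?thesis
    unfolding prob_given_def
  proof (rule S.real_cond_exp_charact[OF _ _ int WF])
    show "integrable M (indicator ?E :: _ \<Rightarrow> real)"
      using E by (intro integrable_real_indicator) (auto simp: emeasure_eq_measure)
    fix C assume "C \<in> sets ?F"
    then obtain B where B: "B \<in> sets (prob_algebra borel)" and C: "C = p -` B \<inter> space M"
      unfolding sets_sigma_gen[OF p_measurable] by blast
    have CM: "C \<in> events" unfolding C by (rule measurable_sets[OF p_measurable B])
    have "(\<integral>\<omega>\<in>C. indicator ?E \<omega> \<partial>M) = measure M (C \<inter> ?E)"
      unfolding set_lebesgue_integral_def using CM E by (simp flip: indicator_inter_arith)
    also have "C \<inter> ?E = {\<omega>\<in>space M. p \<omega> \<in> B \<and> (\<forall>i\<in>J. Z (I i \<omega>) \<omega> \<in> A i)}"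
      unfolding C by blast
    also have "ennreal (measure M \<dots>) = (\<integral>\<^sup>+\<omega>. indicator B (p \<omega>) * ennreal (\<Prod>i\<in>J. measure (p \<omega>) (A i)) \<partial>M)"
      unfolding emeasure_eq_measure[symmetric] by (rule joint_law[OF J A B])
    also have "\<dots> = (\<integral>\<^sup>+\<omega>. ennreal (indicator C \<omega> * (\<Prod>i\<in>J. measure (p \<omega>) (A i))) \<partial>M)"
      by (rule nn_integral_cong) (auto simp: C indicator_def)
    also have "\<dots> = ennreal (\<integral>\<omega>\<in>C. (\<Prod>i\<in>J. measure (p \<omega>) (A i)) \<partial>M)"
      unfolding set_lebesgue_integral_def using integrable_mult_indicator[OF CM int] W0
      by (subst nn_integral_eq_integral) auto
    finally show "(\<integral>\<omega>\<in>C. indicator ?E \<omega> \<partial>M) = (\<integral>\<omega>\<in>C. (\<Prod>i\<in>J. measure (p \<omega>) (A i)) \<partial>M)"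
      using W0 by (subst (asm) ennreal_inj) (auto simp: set_lebesgue_integral_def intro!: integral_nonneg_AE)
  qed
qed

text \<open>One formula gives both halves: a single position yields \<open>p\<close> as conditional
  law, and inserting this into the formula for several positions yields conditional
  independence.\<close>

lemma cond_iid_given_p: "cond_iid_given M (\<lambda>n \<omega>. Z (I n \<omega>) \<omega>) p"
proof -
  have single: "AE \<omega> in M. prob_given M (sigma_gen M (prob_algebra borel) p)
      {\<omega>\<in>space M. Z (I n \<omega>) \<omega> \<in> A} \<omega> = measure (p \<omega>) A" if "A \<in> sets borel" for n A
    using prob_given_atoms[of "{n}" "\<lambda>_. A"] that by simp
  have "AE \<omega> in M. prob_given M (sigma_gen M (prob_algebra borel) p)
      {\<omega>\<in>space M. \<forall>i\<in>J. Z (I i \<omega>) \<omega> \<in> A i} \<omega> =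
      (\<Prod>i\<in>J. prob_given M (sigma_gen M (prob_algebra borel) p) {\<omega>\<in>space M. Z (I i \<omega>) \<omega> \<in> A i} \<omega>)"
    if J: "finite J" and A: "\<forall>i\<in>J. A i \<in> sets borel" for J A
  proof -
    have "AE \<omega> in M. \<forall>i\<in>J. prob_given M (sigma_gen M (prob_algebra borel) p)
        {\<omega>\<in>space M. Z (I i \<omega>) \<omega> \<in> A i} \<omega> = measure (p \<omega>) (A i)"
      using J A single by (intro AE_finite_allI) auto
    with prob_given_atoms[OF J, of A] show ?thesis
      using A by (auto elim: eventually_elim2)
  qed
  then show ?thesis
    unfolding cond_iid_given_def cond_indep_seq_def
    using single p_measurable atom_measurable by blast
qed

text \<open>The right-hand side does not involve \<open>\<sigma>\<close>, which is exchangeability.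
  It is \<open>joint_law\<close> with no constraint on \<open>p\<close>.\<close>

lemma law_permuted:
  assumes J: "finite J" and A: "\<And>i. i \<in> J \<Longrightarrow> A i \<in> sets borel" and \<sigma>: "inj \<sigma>"
  shows "emeasure M {\<omega>\<in>space M. \<forall>i\<in>J. Z (I (\<sigma> i) \<omega>) \<omega> \<in> A i} =
    (\<integral>\<^sup>+\<omega>. ennreal (\<Prod>i\<in>J. measure (p \<omega>) (A i)) \<partial>M)"
proof -
  \<comment> \<open>The sets are moved to the positions where they are tested, so that
    \<open>A i\<close> belongs to position \<open>\<sigma> i\<close>.\<close>
  define A' where "A' i = A (inv \<sigma> i)" for i
  have A': "A' (\<sigma> i) = A i" for i using \<sigma> by (simp add: A'_def)
  have sp: "p \<omega> \<in> space (prob_algebra borel)" if "\<omega> \<in> space M" for \<omega>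
    using measurable_space[OF p_measurable that] .
  have "{\<omega>\<in>space M. \<forall>i\<in>J. Z (I (\<sigma> i) \<omega>) \<omega> \<in> A i} =
      {\<omega>\<in>space M. p \<omega> \<in> space (prob_algebra borel) \<and> (\<forall>i\<in>\<sigma> ` J. Z (I i \<omega>) \<omega> \<in> A' i)}"
    using sp by (auto simp: A')
  then have "emeasure M {\<omega>\<in>space M. \<forall>i\<in>J. Z (I (\<sigma> i) \<omega>) \<omega> \<in> A i} =
      emeasure M {\<omega>\<in>space M. p \<omega> \<in> space (prob_algebra borel) \<and> (\<forall>i\<in>\<sigma> ` J. Z (I i \<omega>) \<omega> \<in> A' i)}"
    by (rule arg_cong)
  also have "\<dots> = (\<integral>\<^sup>+\<omega>. indicator (space (prob_algebra borel)) (p \<omega>) *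
      ennreal (\<Prod>i\<in>\<sigma> ` J. measure (p \<omega>) (A' i)) \<partial>M)"
    by (rule joint_law) (use J A in \<open>auto simp: A'\<close>)
  also have "\<dots> = (\<integral>\<^sup>+\<omega>. ennreal (\<Prod>i\<in>J. measure (p \<omega>) (A i)) \<partial>M)"
    using sp by (intro nn_integral_cong)
      (simp add: prod.reindex[OF inj_on_subset[OF \<sigma> subset_UNIV]] A' comp_def)
  finally show ?thesis .
qed

end

section \<open>Laws of sequences from finitely many coordinates, and exchangeability\<close>

lemma emeasure_distr_prod_emb:
  fixes X :: "nat \<Rightarrow> 'a \<Rightarrow> 'b"
  assumes X: "\<And>i. X i \<in> M \<rightarrow>\<^sub>M N" and J: "finite J" and A: "\<And>i. i \<in> J \<Longrightarrow> A i \<in> sets N"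
  shows "emeasure (distr M (PiM UNIV (\<lambda>_. N)) (\<lambda>\<omega> i. X i \<omega>)) (prod_emb UNIV (\<lambda>_. N) J (Pi\<^sub>E J A)) =
    emeasure M {\<omega>\<in>space M. \<forall>i\<in>J. X i \<omega> \<in> A i}"
proof -
  have m: "(\<lambda>\<omega> i. X i \<omega>) \<in> M \<rightarrow>\<^sub>M PiM UNIV (\<lambda>_. N)"
    by (rule measurable_PiM_single') (use X measurable_space[OF X] in auto)
  have "(\<lambda>\<omega> i. X i \<omega>) -` prod_emb UNIV (\<lambda>_. N) J (Pi\<^sub>E J A) \<inter> space M =
      {\<omega>\<in>space M. \<forall>i\<in>J. X i \<omega> \<in> A i}"
    using measurable_space[OF X] by (auto simp: prod_emb_def PiE_iff)
  then show ?thesis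
    using sets_PiM_I[of J UNIV A "\<lambda>_. N"] J A by (simp add: emeasure_distr[OF m])
qed

lemma distr_PiM_eqI:
  fixes X Y :: "nat \<Rightarrow> 'a \<Rightarrow> 'b"
  assumes "prob_space M" and X: "\<And>i. X i \<in> M \<rightarrow>\<^sub>M N" and Y: "\<And>i. Y i \<in> M \<rightarrow>\<^sub>M N"
    and eq: "\<And>J A. finite J \<Longrightarrow> (\<And>i. i \<in> J \<Longrightarrow> A i \<in> sets N) \<Longrightarrow>
      emeasure M {\<omega>\<in>space M. \<forall>i\<in>J. X i \<omega> \<in> A i} = emeasure M {\<omega>\<in>space M. \<forall>i\<in>J. Y i \<omega> \<in> A i}"
  shows "distr M (PiM UNIV (\<lambda>_. N)) (\<lambda>\<omega> i. X i \<omega>) = distr M (PiM UNIV (\<lambda>_. N)) (\<lambda>\<omega> i. Y i \<omega>)"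
proof (rule measure_eqI_PiM_infinite)
  interpret prob_space M by fact
  have "(\<lambda>\<omega> i. X i \<omega>) \<in> M \<rightarrow>\<^sub>M PiM UNIV (\<lambda>_. N)"
    by (rule measurable_PiM_single') (use X measurable_space[OF X] in auto)
  then show "finite_measure (distr M (PiM UNIV (\<lambda>_. N)) (\<lambda>\<omega> i. X i \<omega>))"
    by (rule finite_measure_distr)
  fix A and J :: "nat set" assume J: "finite J" and A: "\<And>i. i \<in> J \<Longrightarrow> A i \<in> sets N"
  show "emeasure (distr M (PiM UNIV (\<lambda>_. N)) (\<lambda>\<omega> i. X i \<omega>)) (prod_emb UNIV (\<lambda>_. N) J (Pi\<^sub>E J A)) =
      emeasure (distr M (PiM UNIV (\<lambda>_. N)) (\<lambda>\<omega> i. Y i \<omega>)) (prod_emb UNIV (\<lambda>_. N) J (Pi\<^sub>E J A))"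
    using eq[of J A] emeasure_distr_prod_emb[of X M N J A] emeasure_distr_prod_emb[of Y M N J A] X Y J A
    by presburger
qed simp_all

context species_sampling_sequence
begin

lemma exchangeable_seq_atoms: "exchangeable_seq M (\<lambda>n \<omega>. Z (I n \<omega>) \<omega>)"
  unfolding exchangeable_seq_def
proof (intro conjI allI impI)
  show "(\<lambda>\<omega>. Z (I n \<omega>) \<omega>) \<in> borel_measurable M" for n by (rule atom_measurable)
  fix n and \<sigma> :: "nat \<Rightarrow> nat" assume "\<sigma> permutes {..<n}"
  then have \<sigma>: "inj \<sigma>" by (rule permutes_inj)
  show "distr M (PiM UNIV (\<lambda>_. borel)) (\<lambda>\<omega> i. Z (I (\<sigma> i) \<omega>) \<omega>) =
      distr M (PiM UNIV (\<lambda>_. borel)) (\<lambda>\<omega> i. Z (I i \<omega>) \<omega>)"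
  proof (rule distr_PiM_eqI[OF prob_space_axioms atom_measurable atom_measurable])
    fix J and A :: "nat \<Rightarrow> 'x set" assume "finite J" "\<And>i. i \<in> J \<Longrightarrow> A i \<in> sets borel"
    then show "emeasure M {\<omega>\<in>space M. \<forall>i\<in>J. Z (I (\<sigma> i) \<omega>) \<omega> \<in> A i} =
        emeasure M {\<omega>\<in>space M. \<forall>i\<in>J. Z (I i \<omega>) \<omega> \<in> A i}"
      using law_permuted[of J A \<sigma>] law_permuted[of J A "\<lambda>i. i"] \<sigma> by simp
  qed
qed

end

section \<open>The law of the directing random measure\<close>


text \<open>For nonnegative terms the sum over tuples becomes an integral, where Tonelli's theorem
  and changes of index set apply without summability conditions.\<close>

lemma has_sum_iff_nn_integral_count_space:
  fixes f :: "'a \<Rightarrow> real"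
  assumes f: "\<And>x. 0 \<le> f x" and s: "0 \<le> s"
  shows "(f has_sum s) A \<longleftrightarrow> (\<integral>\<^sup>+x. ennreal (f x) \<partial>count_space A) = ennreal s"
proof -
  have eq: "(\<integral>\<^sup>+x. ennreal (f x) \<partial>count_space A) = ennreal (infsum f A)" if "Infinite_Set_Sum.abs_summable_on f A"
    using nn_integral_conv_infsetsum[OF that] infsetsum_infsum[OF that] f by simp
  have sum: "f summable_on A \<longleftrightarrow> Infinite_Set_Sum.abs_summable_on f A"
    using abs_summable_equivalent[of f A] f by simp
  show ?thesis
  proof
    assume "(f has_sum s) A"
    then have "f summable_on A" "infsum f A = s" by (auto simp: summable_on_def infsumI)
    then show "(\<integral>\<^sup>+x. ennreal (f x) \<partial>count_space A) = ennreal s" using eq sum by simp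
  next
    assume int: "(\<integral>\<^sup>+x. ennreal (f x) \<partial>count_space A) = ennreal s"
    have "integrable (count_space A) f"
      by (rule integrableI_nonneg) (simp_all add: f int)
    then have abs: "Infinite_Set_Sum.abs_summable_on f A" by (simp add: abs_summable_on_def)
    then have "ennreal (infsum f A) = ennreal s" using eq int by simp
    then have "infsum f A = s" using f s by (simp add: infsum_nonneg)
    then show "(f has_sum s) A" using abs sum by (auto simp: has_sum_infsum)
  qed
qed

text \<open>A rearrangement matches the positive entries only; the two sequences may have different
  numbers of zeros. But all exponents are positive, so a tuple that meets a zero weight contributes
  nothing, and on the remaining tuples \<open>map f\<close> is a bijection.\<close>

lemma nn_integral_distinct_lists_rearrange:
  assumes dec: "decreasing_rearrangement w v" and w: "\<And>j. 0 \<le> w j" and ns: "positive_tuple ns"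
  shows "(\<integral>\<^sup>+js. ennreal (\<Prod>i<length ns. v (js ! i) ^ (ns ! i)) \<partial>count_space {js. length js = length ns \<and> distinct js}) =
    (\<integral>\<^sup>+js. ennreal (\<Prod>i<length ns. w (js ! i) ^ (ns ! i)) \<partial>count_space {js. length js = length ns \<and> distinct js})"
proof -
  obtain f where f: "bij_betw f {k. 0 < v k} {j. 0 < w j}" and vf: "\<And>k. 0 < v k \<Longrightarrow> v k = w (f k)"
    and v: "\<And>k. 0 \<le> v k"
    using dec by (auto simp: decreasing_rearrangement_def)
  define L where "L u = {js. length js = length ns \<and> distinct js \<and> set js \<subseteq> {j. 0 < u j}}" for u :: "nat \<Rightarrow> real"
  have restrict: "(\<integral>\<^sup>+js. ennreal (\<Prod>i<length ns. u (js ! i) ^ (ns ! i)) \<partial>count_space {js. length js = length ns \<and> distinct js}) =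
      (\<integral>\<^sup>+js. ennreal (\<Prod>i<length ns. u (js ! i) ^ (ns ! i)) \<partial>count_space (L u))"
    if u: "\<And>j. 0 \<le> u j" for u
  proof (rule nn_integral_count_space_eq)
    fix js assume "js \<in> {js. length js = length ns \<and> distinct js} - L u"
    then obtain i where i: "i < length ns" "\<not> 0 < u (js ! i)"
      by (auto simp: L_def in_set_conv_nth subset_iff)
    then have "u (js ! i) = 0" using u[of "js ! i"] by simp
    moreover have "0 < ns ! i" using ns i by (simp add: positive_tuple_def)
    ultimately have "(\<Prod>i<length ns. u (js ! i) ^ (ns ! i)) = 0"
      using i by (intro prod_zero) (auto intro!: bexI[of _ i])
    then show "ennreal (\<Prod>i<length ns. u (js ! i) ^ (ns ! i)) = 0" by (simp only: ennreal_0)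
  qed (auto simp: L_def)
  have bij: "bij_betw (map f) (L v) (L w)"
  proof (rule bij_betw_imageI)
    have inj: "inj_on f {k. 0 < v k}" and im: "f ` {k. 0 < v k} = {j. 0 < w j}"
      using f by (auto simp: bij_betw_def)
    show "inj_on (map f) (L v)"
      by (rule inj_on_mapI, rule inj_on_subset[OF inj]) (auto simp: L_def)
    show "map f ` L v = L w"
    proof (intro set_eqI iffI)
      fix js assume "js \<in> map f ` L v"
      then obtain ks where ks: "ks \<in> L v" "js = map f ks" by blast
      have "inj_on f (set ks)" using ks inj inj_on_subset by (auto simp: L_def)
      moreover have "f ` set ks \<subseteq> {j. 0 < w j}" using ks im by (auto simp: L_def)
      ultimately show "js \<in> L w" using ks by (simp add: L_def distinct_map)
    next
      fix js assume js: "js \<in> L w"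
      let ?g = "inv_into {k. 0 < v k} f"
      have fg: "f (?g j) = j" "0 < v (?g j)" if "j \<in> set js" for j
      proof -
        have "j \<in> f ` {k. 0 < v k}" using js that im by (auto simp: L_def)
        then show "f (?g j) = j" "0 < v (?g j)"
          using f_inv_into_f[of j f "{k. 0 < v k}"] inv_into_into[of j f "{k. 0 < v k}"] by simp_all
      qed
      have "map f (map ?g js) = js" using fg by (simp add: map_idI)
      moreover have "inj_on ?g (set js)" by (rule inj_on_inverseI[where g=f]) (use fg in simp)
      then have "map ?g js \<in> L v" using js fg by (auto simp: L_def distinct_map)
      ultimately show "js \<in> map f ` L v" by (metis imageI)
    qed
  qed
  have "(\<integral>\<^sup>+js. ennreal (\<Prod>i<length ns. v (js ! i) ^ (ns ! i)) \<partial>count_space (L v)) =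
      (\<integral>\<^sup>+js. ennreal (\<Prod>i<length ns. w (map f js ! i) ^ (ns ! i)) \<partial>count_space (L v))"
  proof (intro nn_integral_cong arg_cong[where f=ennreal] prod.cong refl)
    fix js i assume "js \<in> space (count_space (L v))" and "i \<in> {..<length ns}"
    then have "i < length js" "set js \<subseteq> {j. 0 < v j}" by (simp_all add: L_def)
    moreover from this have "0 < v (js ! i)" using nth_mem by blast
    ultimately show "v (js ! i) ^ (ns ! i) = w (map f js ! i) ^ (ns ! i)" using vf by simp
  qed
  also have "\<dots> = (\<integral>\<^sup>+js. ennreal (\<Prod>i<length ns. w (js ! i) ^ (ns ! i)) \<partial>count_space (L w))"
    by (rule nn_integral_bij_count_space[OF bij])
  finally show ?thesis by (simp only: restrict[of v, OF v] restrict[of w, OF w])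
qed

text \<open>The bounds turn every expectation into a nonnegative integral; then Tonelli's theorem
  applies to the countable set of tuples.\<close>

lemma nn_integral_distinct_lists_swap:
  fixes u :: "nat \<Rightarrow> 'a \<Rightarrow> real"
  assumes "prob_space M" and u[measurable]: "\<And>j. u j \<in> borel_measurable M"
    and u01: "AE \<omega> in M. \<forall>j. 0 \<le> u j \<omega> \<and> u j \<omega> \<le> 1"
  shows "(\<integral>\<^sup>+js. ennreal (\<integral>\<omega>. (\<Prod>i<length ns. u (js ! i) \<omega> ^ (ns ! i)) \<partial>M) \<partial>count_space {js. length js = length ns \<and> distinct js}) =
    (\<integral>\<^sup>+\<omega>. (\<integral>\<^sup>+js. ennreal (\<Prod>i<length ns. u (js ! i) \<omega> ^ (ns ! i)) \<partial>count_space {js. length js = length ns \<and> distinct js}) \<partial>M)"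
proof -
  interpret prob_space M by fact
  have eq: "ennreal (\<integral>\<omega>. (\<Prod>i<length ns. u (js ! i) \<omega> ^ (ns ! i)) \<partial>M) =
      (\<integral>\<^sup>+\<omega>. ennreal (\<Prod>i<length ns. u (js ! i) \<omega> ^ (ns ! i)) \<partial>M)" for js
  proof (rule nn_integral_eq_integral[symmetric])
    have b: "AE \<omega> in M. 0 \<le> (\<Prod>i<length ns. u (js ! i) \<omega> ^ (ns ! i)) \<and>
        (\<Prod>i<length ns. u (js ! i) \<omega> ^ (ns ! i)) \<le> 1"
      using u01 by eventually_elim (auto intro!: prod_nonneg prod_le_1 power_le_one)
    then show "AE \<omega> in M. 0 \<le> (\<Prod>i<length ns. u (js ! i) \<omega> ^ (ns ! i))"
      by eventually_elim simp
    show "integrable M (\<lambda>\<omega>. \<Prod>i<length ns. u (js ! i) \<omega> ^ (ns ! i))"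
      by (rule integrable_const_bound[where B=1]) (use b in \<open>eventually_elim, simp\<close>, measurable)
  qed
  show ?thesis
    unfolding eq
    by (rule nn_integral_count_space_nn_integral[OF countableI_type, symmetric]) measurable
qed

lemma proper_weights_sums:
  assumes "proper_weights u"
  shows "u sums 1"
proof -
  have u: "\<And>k. 0 \<le> u k" "(\<Sum>k. ennreal (u k)) = 1" using assms by (auto simp: proper_weights_def)
  have sm: "summable u" by (rule summable_suminf_not_top) (use u in auto)
  have "ennreal (suminf u) = ennreal 1" using suminf_ennreal2[OF u(1) sm] u(2) by simp
  then show ?thesis using sm u(1) by (simp add: sums_iff suminf_nonneg)
qed

lemma sums_one_imp_le_one:
  fixes u :: "nat \<Rightarrow> real"
  assumes "u sums 1" "\<And>j. 0 \<le> u j"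
  shows "u j \<le> 1"
  using sum_le_suminf[of u "{j}"] assms by (auto simp: sums_iff)

text \<open>Moves independence to an image space, namely the space of pairs of weights and atoms on
  which \<open>SSrp_law\<close> asks for a representation.\<close>

lemma distr_indep_rv:
  assumes "prob_space M" and T: "T \<in> M \<rightarrow>\<^sub>M K" and X: "X \<in> K \<rightarrow>\<^sub>M N" and Y: "Y \<in> K \<rightarrow>\<^sub>M L"
    and ind: "indep_rv M N (\<lambda>\<omega>. X (T \<omega>)) L (\<lambda>\<omega>. Y (T \<omega>))"
  shows "indep_rv (distr M K T) N X L Y"
proof -
  have D: "prob_space (distr M K T)" using assms(1) T by (rule prob_space.prob_space_distr)
  have m: "measure (distr M K T) {x\<in>space (distr M K T). Q x} = measure M {\<omega>\<in>space M. Q (T \<omega>)}"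
    if "{x\<in>space K. Q x} \<in> sets K" for Q
  proof -
    have "T -` {x\<in>space K. Q x} \<inter> space M = {\<omega>\<in>space M. Q (T \<omega>)}"
      using measurable_space[OF T] by auto
    then show ?thesis using measure_distr[OF T that] by simp
  qed
  show ?thesis
    unfolding indep_rv_iff[OF D]
  proof (intro conjI ballI)
    show "X \<in> distr M K T \<rightarrow>\<^sub>M N" "Y \<in> distr M K T \<rightarrow>\<^sub>M L" using X Y by simp_all
    fix A B assume A: "A \<in> sets N" and B: "B \<in> sets L"
    have XA: "{x\<in>space K. X x \<in> A} \<in> sets K" and YB: "{x\<in>space K. Y x \<in> B} \<in> sets K"
      using measurable_sets[OF X A] measurable_sets[OF Y B] by (simp_all add: vimage_def Int_def conj_commute)
    have XY: "{x\<in>space K. X x \<in> A \<and> Y x \<in> B} \<in> sets K"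
      by (intro sets.sets_Collect_conj XA YB)
    show "measure (distr M K T) {\<omega>\<in>space (distr M K T). X \<omega> \<in> A \<and> Y \<omega> \<in> B} =
        measure (distr M K T) {\<omega>\<in>space (distr M K T). X \<omega> \<in> A} *
        measure (distr M K T) {\<omega>\<in>space (distr M K T). Y \<omega> \<in> B}"
      unfolding m[OF XA] m[OF YB] m[OF XY] using ind A B unfolding indep_rv_iff[OF assms(1)] by blast
  qed
qed

context species_sampling_sequence
begin

lemma V_component_measurable [measurable]: "(\<lambda>\<omega>. V \<omega> j) \<in> borel_measurable M"
  using measurable_compose[OF V_measurable measurable_component_singleton[of j]] by simp

lemma V_nonneg: "0 \<le> V \<omega> j" and V_le_1: "V \<omega> j \<le> 1"
proof -
  show "0 \<le> V \<omega> j" for j using V_proper by (simp add: proper_weights_def)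
  then show "V \<omega> j \<le> 1" using sums_one_imp_le_one[OF proper_weights_sums[OF V_proper]] by simp
qed

text \<open>The hypothesis on \<open>q\<close> concerns the unsorted weights \<open>w\<close>. With
  the sum moved inside the expectation, sorted and unsorted weights can be compared at almost every
  sample point.\<close>

lemma has_sum_eppf:
  assumes sp: "species_sampling M q H p0 w Z"
    and dec: "AE \<omega> in M. decreasing_rearrangement (\<lambda>j. w j \<omega>) (\<lambda>k. v k \<omega>)"
    and ns: "positive_tuple ns"
  shows "((\<lambda>js. \<integral>\<omega>. (\<Prod>i<length ns. V \<omega> (js ! i) ^ (ns ! i)) \<partial>M) has_sum q ns)
    {js. length js = length ns \<and> distinct js}"
proof -
  let ?L = "{js. length js = length ns \<and> distinct js}"
  have [measurable]: "\<And>j. w j \<in> borel_measurable M" and w0: "\<And>j \<omega>. \<omega> \<in> space M \<Longrightarrow> 0 \<le> w j \<omega>"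
    and w1: "AE \<omega> in M. (\<lambda>j. w j \<omega>) sums 1"
    and sum: "((\<lambda>js. \<integral>\<omega>. (\<Prod>i<length ns. w (js ! i) \<omega> ^ (ns ! i)) \<partial>M) has_sum q ns) ?L"
    using sp ns by (auto simp: species_sampling_def)
  have w01: "AE \<omega> in M. \<forall>j. 0 \<le> w j \<omega> \<and> w j \<omega> \<le> 1"
    using w1 AE_space
  proof eventually_elim
    case (elim \<omega>)
    then show ?case using w0[OF elim(2)] sums_one_imp_le_one[OF elim(1) w0[OF elim(2)]] by blast
  qed
  have pos: "0 \<le> (\<integral>\<omega>. (\<Prod>i<length ns. w (js ! i) \<omega> ^ (ns ! i)) \<partial>M)" for js
    by (rule integral_nonneg_AE) (use w0 AE_space in \<open>auto intro!: prod_nonneg elim!: eventually_mono\<close>)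
  have q0: "0 \<le> q ns" using sum pos by (rule has_sum_nonneg)
  have "(\<integral>\<^sup>+js. ennreal (\<integral>\<omega>. (\<Prod>i<length ns. V \<omega> (js ! i) ^ (ns ! i)) \<partial>M) \<partial>count_space ?L) =
      (\<integral>\<^sup>+\<omega>. (\<integral>\<^sup>+js. ennreal (\<Prod>i<length ns. V \<omega> (js ! i) ^ (ns ! i)) \<partial>count_space ?L) \<partial>M)"
    by (rule nn_integral_distinct_lists_swap[OF prob_space_axioms, of "\<lambda>j \<omega>. V \<omega> j"])
       (auto simp: V_nonneg V_le_1)
  also have "\<dots> = (\<integral>\<^sup>+\<omega>. (\<integral>\<^sup>+js. ennreal (\<Prod>i<length ns. w (js ! i) \<omega> ^ (ns ! i)) \<partial>count_space ?L) \<partial>M)"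
  proof (rule nn_integral_cong_AE)
    show "AE \<omega> in M. (\<integral>\<^sup>+js. ennreal (\<Prod>i<length ns. V \<omega> (js ! i) ^ (ns ! i)) \<partial>count_space ?L) =
        (\<integral>\<^sup>+js. ennreal (\<Prod>i<length ns. w (js ! i) \<omega> ^ (ns ! i)) \<partial>count_space ?L)"
      using dec F_I AE_space
    proof eventually_elim
      case (elim \<omega>)
      have "V \<omega> = (\<lambda>k. v k \<omega>)" using elim(2) by (simp add: V_def)
      then show ?case
        using nn_integral_distinct_lists_rearrange[OF elim(1) w0[OF elim(3)] ns] by simp
    qed
  qed
  also have "\<dots> = (\<integral>\<^sup>+js. ennreal (\<integral>\<omega>. (\<Prod>i<length ns. w (js ! i) \<omega> ^ (ns ! i)) \<partial>M) \<partial>count_space ?L)"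
    by (rule nn_integral_distinct_lists_swap[OF prob_space_axioms _ w01, symmetric]) measurable
  also have "\<dots> = ennreal (q ns)"
    by (rule iffD1[OF has_sum_iff_nn_integral_count_space[where
          f="\<lambda>js. \<integral>\<omega>. (\<Prod>i<length ns. w (js ! i) \<omega> ^ (ns ! i)) \<partial>M", OF pos q0] sum])
  finally show ?thesis
    by (subst has_sum_iff_nn_integral_count_space)
       (auto simp: q0 V_nonneg intro!: integral_nonneg_AE prod_nonneg)
qed

text \<open>The pair of weights and atoms is pushed forward to its joint law, which lives on the
  sample space type fixed in \<open>SSrp_law\<close>.\<close>

lemma SSrp_law_p:
  assumes sp: "species_sampling M q H p0 w Z"
    and dec: "AE \<omega> in M. decreasing_rearrangement (\<lambda>j. w j \<omega>) (\<lambda>k. v k \<omega>)"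
  shows "SSrp_law q H (distr M (prob_algebra borel) p)"
proof -
  let ?W = "PiM UNIV (\<lambda>_. borel) :: (nat \<Rightarrow> real) measure"
  let ?Z = "PiM UNIV (\<lambda>_. borel) :: (nat \<Rightarrow> 'x) measure"
  let ?K = "?W \<Otimes>\<^sub>M ?Z"
  define T where "T \<omega> = (V \<omega>, \<lambda>j. Z j \<omega>)" for \<omega>
  have T: "T \<in> M \<rightarrow>\<^sub>M ?K"
    unfolding T_def by (rule measurable_Pair[OF V_measurable Z_seq_measurable])
  define N where "N = distr M ?K T"
  interpret N: prob_space N unfolding N_def by (rule prob_space_distr[OF T])
  \<comment> \<open>The first coordinate ranges over all real sequences, while nonnegativity and a
    probability measure are demanded at every point of the new space; on the values of
    \<open>T\<close> the normalization changes nothing.\<close>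
  define n where "n x = normalize_weights (fst x)" for x :: "(nat \<Rightarrow> real) \<times> (nat \<Rightarrow> 'x)"
  have nT: "n (T \<omega>) = V \<omega>" for \<omega>
    using V_proper by (simp add: n_def T_def normalize_weights_def)
  have n: "n \<in> ?K \<rightarrow>\<^sub>M ?W"
    unfolding n_def by (rule measurable_compose[OF measurable_fst measurable_normalize_weights])
  have nj: "(\<lambda>x. n x j) \<in> borel_measurable ?K" for j
    using measurable_compose[OF n measurable_component_singleton[of j]] by simp
  have n_proper: "proper_weights (n x)" for x unfolding n_def by (rule proper_normalize_weights)
  define p' where "p' x = discrete_measure (n x) (snd x)" for x :: "(nat \<Rightarrow> real) \<times> (nat \<Rightarrow> 'x)"
  have p': "p' \<in> ?K \<rightarrow>\<^sub>M prob_algebra borel"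
    unfolding p'_def by (rule measurable_discrete_measure[OF n measurable_snd n_proper])
  have sj: "(\<lambda>x. snd x j) \<in> ?K \<rightarrow>\<^sub>M borel" for j
    using measurable_compose[OF measurable_snd measurable_component_singleton[of j]] by simp
  have Zind: "indep_vars (\<lambda>_. borel) Z UNIV" and H: "\<And>j. distr M borel (Z j) = H"
    using sp by (auto simp: species_sampling_def)
  have distr_Z: "distr N borel (\<lambda>x. snd x j) = distr M borel (Z j)" for j
    unfolding N_def by (subst distr_distr[OF sj T]) (simp add: T_def comp_def)
  have "species_sampling N q H p' (\<lambda>j x. n x j) (\<lambda>j x. snd x j)"
    unfolding species_sampling_def
  proof (intro conjI allI ballI impI)
    show "p' \<in> N \<rightarrow>\<^sub>M prob_algebra borel" unfolding N_def using p' by simp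
    show "AE x in N. p' x = discrete_measure (\<lambda>j. n x j) (\<lambda>j. snd x j)" by (simp add: p'_def)
    show "(\<lambda>x. n x j) \<in> borel_measurable N" for j unfolding N_def using nj by simp
    show "0 \<le> n x j" for x j using n_proper[of x] by (simp add: proper_weights_def)
    show "AE x in N. (\<lambda>j. n x j) sums 1" using proper_weights_sums[OF n_proper] by simp
    show "N.indep_vars (\<lambda>_. borel) (\<lambda>j x. snd x j) UNIV"
    proof (subst N.indep_vars_iff_distr_eq_PiM)
      have "distr N ?Z (\<lambda>x. \<lambda>j\<in>UNIV. snd x j) = distr M ?Z (\<lambda>\<omega>. \<lambda>j\<in>UNIV. Z j \<omega>)"
        unfolding N_def by (subst distr_distr[OF _ T]) (simp_all add: T_def comp_def)
      also have "\<dots> = PiM UNIV (\<lambda>j. distr M borel (Z j))"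
        using Zind by (subst (asm) indep_vars_iff_distr_eq_PiM) auto
      finally show "distr N ?Z (\<lambda>x. \<lambda>j\<in>UNIV. snd x j) = PiM UNIV (\<lambda>j. distr N borel (\<lambda>x. snd x j))"
        by (simp only: distr_Z)
      show "(\<lambda>x. snd x j) \<in> borel_measurable N" for j unfolding N_def using sj by simp
    qed simp
    show "distr N borel (\<lambda>x. snd x j) = H" for j by (simp add: distr_Z H)
    \<comment> \<open>The recovered weights are a function of the indices, so they inherit
      independence from the atoms.\<close>
    have "indep_rv M ?W V ?Z (\<lambda>\<omega> j. Z j \<omega>)"
      by (rule indep_rv_compose_left[OF prob_space_axioms I_Z_indep F_measurable]) (simp add: V_def)
    then show "indep_rv N ?W (\<lambda>x j. n x j) ?Z (\<lambda>x j. snd x j)"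
      unfolding N_def by (intro distr_indep_rv[OF prob_space_axioms T n measurable_snd]) (simp add: nT, simp add: T_def)
    fix ns assume ns: "positive_tuple ns"
    have "(\<integral>x. (\<Prod>i<length ns. n x (js ! i) ^ (ns ! i)) \<partial>N) =
        (\<integral>\<omega>. (\<Prod>i<length ns. V \<omega> (js ! i) ^ (ns ! i)) \<partial>M)" for js
      unfolding N_def by (subst integral_distr[OF T]) (use nj in \<open>simp_all add: nT\<close>)
    then show "((\<lambda>js. \<integral>x. (\<Prod>i<length ns. n x (js ! i) ^ (ns ! i)) \<partial>N) has_sum q ns)
        {js. length js = length ns \<and> distinct js}"
      using has_sum_eppf[OF sp dec ns] by simp
  qed
  moreover have "distr M (prob_algebra borel) p = distr N (prob_algebra borel) p'"
    unfolding N_def by (subst distr_distr[OF p' T]) (simp add: comp_def p'_def nT p_def[abs_def], simp add: T_def)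
  ultimately show ?thesis
    unfolding SSrp_law_def using N.prob_space_axioms by blast
qed

lemma gSSS_atoms:
  assumes sp: "species_sampling M q H p0 w Z"
    and dec: "AE \<omega> in M. decreasing_rearrangement (\<lambda>j. w j \<omega>) (\<lambda>k. v k \<omega>)"
  shows "gSSS M q H (\<lambda>n \<omega>. Z (I n \<omega>) \<omega>)"
  unfolding gSSS_def using exchangeable_seq_atoms cond_iid_given_p SSrp_law_p[OF assms] by blast

end

section \<open>The partition induced by the indices\<close>


lemma nth_blocks_in:
  assumes "\<pi> \<in> partitions n" "d < card \<pi>"
  shows "blocks \<pi> ! d \<in> \<pi>"
  using blocks_partition(1,2)[OF assms(1)] assms(2) nth_mem by metis

lemma nth_blocks_unique:
  assumes \<pi>: "\<pi> \<in> partitions n" and d: "d < card \<pi>" "i \<in> blocks \<pi> ! d"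
    and e: "e < card \<pi>" "i \<in> blocks \<pi> ! e"
  shows "d = e"
proof -
  have "blocks \<pi> ! e = blocks \<pi> ! d"
    using partitionsD(4)[OF \<pi> nth_blocks_in[OF \<pi> d(1)] nth_blocks_in[OF \<pi> e(1)] d(2) e(2)] .
  then show ?thesis
    using blocks_partition(2,3)[OF \<pi>] d(1) e(1) by (simp add: nth_eq_iff_index_eq)
qed

text \<open>Splits the event of having kernel \<open>\<pi>\<close> by the values taken on the
  blocks, which are exactly the tuples of distinct indices summed over in the formula for
  \<open>q\<close>. Here \<open>c i\<close> is the number of the block that contains
  \<open>i\<close>.\<close>

lemma kernel_partition_eq_iff_blocks:
  assumes \<pi>: "\<pi> \<in> partitions n"
    and c: "\<And>i. i < n \<Longrightarrow> c i < card \<pi> \<and> i \<in> blocks \<pi> ! c i"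
  shows "kernel_partition n f = \<pi> \<longleftrightarrow>
    (\<exists>js. length js = card \<pi> \<and> distinct js \<and> (\<forall>i<n. f i = js ! c i))"
proof -
  let ?b = "blocks \<pi>"
  note b = blocks_partition[OF \<pi>]
  note bnth = nth_blocks_in[OF \<pi>]
  have cd: "c i = d" if "i < n" "d < card \<pi>" "i \<in> ?b ! d" for i d
    using nth_blocks_unique[OF \<pi>] c[OF that(1)] that(2,3) by blast
  have same: "(\<exists>B\<in>\<pi>. i \<in> B \<and> j \<in> B) \<longleftrightarrow> c i = c j" if ij: "i < n" "j < n" for i j
  proof
    assume "\<exists>B\<in>\<pi>. i \<in> B \<and> j \<in> B"
    then obtain B where B: "B \<in> \<pi>" "i \<in> B" "j \<in> B" by blast
    then obtain d where "d < card \<pi>" "B = ?b ! d" using b(1,2) by (metis in_set_conv_nth)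
    then show "c i = c j" using cd[OF ij(1), of d] cd[OF ij(2), of d] B by simp
  next
    assume "c i = c j"
    then show "\<exists>B\<in>\<pi>. i \<in> B \<and> j \<in> B" using c[OF ij(1)] c[OF ij(2)] bnth by metis
  qed
  show ?thesis
    unfolding kernel_partition_eq_iff[OF \<pi>]
  proof
    assume eq: "\<forall>i<n. \<forall>j<n. f i = f j \<longleftrightarrow> (\<exists>B\<in>\<pi>. i \<in> B \<and> j \<in> B)"
    \<comment> \<open>The minimum represents its block, and the tuple lists the values of
      \<open>f\<close> at these representatives.\<close>
    define r where "r d = Min (?b ! d)" for d
    have r: "r d < n" "c (r d) = d" if "d < card \<pi>" for d
    proof -
      note B = partitionsD[OF \<pi> bnth[OF that]]
      have "r d \<in> ?b ! d" unfolding r_def using B(2,3) by (rule Min_in)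
      then show "r d < n" "c (r d) = d" using B(1) cd[OF _ that] by auto
    qed
    have "inj_on (\<lambda>d. f (r d)) {0..<card \<pi>}"
    proof (rule inj_onI)
      fix d e assume de: "d \<in> {0..<card \<pi>}" "e \<in> {0..<card \<pi>}" and f: "f (r d) = f (r e)"
      then have "c (r d) = c (r e)" using eq r[of d] r[of e] same[of "r d" "r e"] by simp
      then show "d = e" using r[of d] r[of e] de by simp
    qed
    moreover have "f i = map (\<lambda>d. f (r d)) [0..<card \<pi>] ! c i" if "i < n" for i
      using eq c[OF that] r[of "c i"] same[OF that, of "r (c i)"] that by simp
    ultimately show "\<exists>js. length js = card \<pi> \<and> distinct js \<and> (\<forall>i<n. f i = js ! c i)"
      by (intro exI[of _ "map (\<lambda>d. f (r d)) [0..<card \<pi>]"]) (simp add: distinct_map)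
  next
    assume "\<exists>js. length js = card \<pi> \<and> distinct js \<and> (\<forall>i<n. f i = js ! c i)"
    then obtain js where js: "length js = card \<pi>" "distinct js" "\<forall>i<n. f i = js ! c i" by blast
    show "\<forall>i<n. \<forall>j<n. f i = f j \<longleftrightarrow> (\<exists>B\<in>\<pi>. i \<in> B \<and> j \<in> B)"
      using js c same by (simp add: nth_eq_iff_index_eq)
  qed
qed

text \<open>The fibre of \<open>c\<close> over \<open>d\<close> is block number \<open>d\<close>, so
  collecting equal factors turns block sizes into exponents.\<close>

lemma prod_nth_blocks:
  fixes h :: "nat \<Rightarrow> real"
  assumes \<pi>: "\<pi> \<in> partitions n"
    and c: "\<And>i. i < n \<Longrightarrow> c i < card \<pi> \<and> i \<in> blocks \<pi> ! c i"
  shows "(\<Prod>i<n. h (c i)) = (\<Prod>d<card \<pi>. h d ^ card (blocks \<pi> ! d))"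
proof -
  let ?b = "blocks \<pi>"
  note b = blocks_partition[OF \<pi>]
  note bnth = nth_blocks_in[OF \<pi>]
  have fibre: "{i\<in>{..<n}. c i = d} = ?b ! d" if d: "d < card \<pi>" for d
  proof (intro set_eqI iffI)
    fix i assume "i \<in> {i\<in>{..<n}. c i = d}" then show "i \<in> ?b ! d" using c by auto
  next
    fix i assume i: "i \<in> ?b ! d"
    then have lt: "i < n" using partitionsD(1)[OF \<pi> bnth[OF d]] by auto
    have "c i = d" using nth_blocks_unique[OF \<pi>] c[OF lt] d i by blast
    then show "i \<in> {i\<in>{..<n}. c i = d}" using lt by simp
  qed
  have "h d ^ card (?b ! d) = (\<Prod>i\<in>{i\<in>{..<n}. c i = d}. h (c i))" if "d < card \<pi>" for d
    unfolding fibre[OF that, symmetric] by simp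
  then have "(\<Prod>d<card \<pi>. h d ^ card (?b ! d)) = (\<Prod>d<card \<pi>. \<Prod>i\<in>{i\<in>{..<n}. c i = d}. h (c i))"
    by (intro prod.cong refl) auto
  also have "\<dots> = (\<Prod>i<n. h (c i))"
    by (rule prod.group) (use c in auto)
  finally show ?thesis by simp
qed

context species_sampling_sequence
begin

text \<open>For a fixed tuple of distinct values on the blocks, the conditional law of the indices
  gives a product of weights raised to the block sizes. The expectations of these products sum to
  \<open>q\<close> by \<open>has_sum_eppf\<close>.\<close>

lemma prob_kernel_partition:
  assumes sp: "species_sampling M q H p0 w Z"
    and dec: "AE \<omega> in M. decreasing_rearrangement (\<lambda>j. w j \<omega>) (\<lambda>k. v k \<omega>)"
    and n: "1 \<le> n" and \<pi>: "\<pi> \<in> partitions n"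
  shows "measure M {\<omega>\<in>space M. kernel_partition n (\<lambda>j. I j \<omega>) = \<pi>} = eppf_at q \<pi>"
proof -
  let ?b = "blocks \<pi>"
  let ?ns = "map card ?b"
  let ?L = "{js :: nat list. length js = card \<pi> \<and> distinct js}"
  note b = blocks_partition[OF \<pi>]
  have "\<exists>d. d < card \<pi> \<and> i \<in> ?b ! d" if i: "i < n" for i
  proof -
    obtain B where "B \<in> \<pi>" "i \<in> B" using partitions_cover[OF \<pi> i] by metis
    then show ?thesis using b(1,2) by (metis in_set_conv_nth)
  qed
  then obtain c where c: "\<And>i. i < n \<Longrightarrow> c i < card \<pi> \<and> i \<in> ?b ! c i" by metis
  have ns: "positive_tuple ?ns"
  proof -
    have "?b \<noteq> []" using c[of 0] n b(2) by auto
    moreover have "0 < card B" if "B \<in> \<pi>" for B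
      using partitionsD[OF \<pi> that] by (simp add: card_gt_0_iff)
    ultimately show ?thesis using b(1) by (auto simp: positive_tuple_def)
  qed
  define E where "E js = {\<omega>\<in>space M. \<forall>i\<in>{..<n}. I i \<omega> \<in> {js ! c i}}" for js
  have EM: "E js \<in> events" for js
    unfolding E_def by (intro sets.sets_Collect_finite_All) auto
  have EV: "emeasure M (E js) = ennreal (\<integral>\<omega>. (\<Prod>i<length ?ns. V \<omega> (js ! i) ^ (?ns ! i)) \<partial>M)" for js
  proof -
    \<comment> \<open>The factor 1 brings the event into the form of
      \<open>nn_integral_I_in_weights\<close> with no constraint on the weights.\<close>
    have "emeasure M (E js) = (\<integral>\<^sup>+\<omega>. indicator UNIV (F (\<lambda>n. I n \<omega>)) * indicator (E js) \<omega> \<partial>M)"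
      using EM by simp
    also have "\<dots> = (\<integral>\<^sup>+\<omega>. indicator UNIV (F (\<lambda>n. I n \<omega>)) *
        ennreal (\<Prod>i\<in>{..<n}. weight (F (\<lambda>n. I n \<omega>)) {js ! c i}) \<partial>M)"
      unfolding E_def by (rule nn_integral_I_in_weights[OF F_measurable F_I])
        (use sets.top[of "PiM UNIV (\<lambda>_. borel) :: (nat \<Rightarrow> real) measure"] in \<open>simp_all add: space_PiM\<close>)
    also have "\<dots> = (\<integral>\<^sup>+\<omega>. ennreal (\<Prod>i<length ?ns. V \<omega> (js ! i) ^ (?ns ! i)) \<partial>M)"
    proof (rule nn_integral_cong)
      fix \<omega>
      have "(\<Prod>i<n. weight (V \<omega>) {js ! c i}) = (\<Prod>i<n. V \<omega> (js ! c i))"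
        by (simp add: weight_singleton V_nonneg)
      also have "\<dots> = (\<Prod>d<card \<pi>. V \<omega> (js ! d) ^ card (?b ! d))"
        by (rule prod_nth_blocks[OF \<pi> c])
      finally show "indicator UNIV (F (\<lambda>n. I n \<omega>)) *
        ennreal (\<Prod>i\<in>{..<n}. weight (F (\<lambda>n. I n \<omega>)) {js ! c i}) =
        ennreal (\<Prod>i<length ?ns. V \<omega> (js ! i) ^ (?ns ! i))"
        by (simp add: V_def b(2))
    qed
    also have "\<dots> = ennreal (\<integral>\<omega>. (\<Prod>i<length ?ns. V \<omega> (js ! i) ^ (?ns ! i)) \<partial>M)"
    proof (rule nn_integral_eq_integral)
      show "integrable M (\<lambda>\<omega>. \<Prod>i<length ?ns. V \<omega> (js ! i) ^ (?ns ! i))"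
        by (rule integrable_AE_bounded[where B=1], measurable)
          (auto intro!: AE_I2 prod_le_1 power_le_one simp: V_nonneg V_le_1 abs_prod)
    qed (auto intro!: prod_nonneg simp: V_nonneg)
    finally show ?thesis .
  qed
  have "{\<omega>\<in>space M. kernel_partition n (\<lambda>j. I j \<omega>) = \<pi>} = (\<Union>js\<in>?L. E js)"
    by (auto simp: kernel_partition_eq_iff_blocks[OF \<pi>, of c, OF c] E_def)
  then have "emeasure M {\<omega>\<in>space M. kernel_partition n (\<lambda>j. I j \<omega>) = \<pi>} = emeasure M (\<Union>js\<in>?L. E js)"
    by (rule arg_cong)
  also have "\<dots> = (\<integral>\<^sup>+js. emeasure M (E js) \<partial>count_space ?L)"
  proof (rule emeasure_UN_countable)
    show "countable ?L" by (rule countableI_type)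
    show "disjoint_family_on E ?L"
      unfolding disjoint_family_on_def
    proof (intro ballI impI, rule ccontr)
      fix js ks assume L: "js \<in> ?L" "ks \<in> ?L" "js \<noteq> ks" "E js \<inter> E ks \<noteq> {}"
      then obtain \<omega> where \<omega>: "\<omega> \<in> E js" "\<omega> \<in> E ks" by blast
      have eq: "js ! c i = ks ! c i" if "i < n" for i using \<omega> that by (auto simp: E_def)
      \<comment> \<open>Blocks are nonempty, so every entry of the tuple is the index at some
        position and can be recovered from the outcome.\<close>
      have "js = ks"
      proof (rule nth_equalityI)
        show "length js = length ks" using L by simp
        fix d assume "d < length js"
        then have d: "d < card \<pi>" using L by simp
        note B = partitionsD[OF \<pi> nth_blocks_in[OF \<pi> d]]
        obtain i where i: "i \<in> ?b ! d" using B(3) by blast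
        then have lt: "i < n" using B(1) by auto
        have "c i = d" using nth_blocks_unique[OF \<pi>] c[OF lt] d i by blast
        then show "js ! d = ks ! d" using eq[OF lt] by simp
      qed
      then show False using L by simp
    qed
  qed (use EM in auto)
  also have "\<dots> = (\<integral>\<^sup>+js. ennreal (\<integral>\<omega>. (\<Prod>i<length ?ns. V \<omega> (js ! i) ^ (?ns ! i)) \<partial>M) \<partial>count_space ?L)"
    unfolding EV ..
  also have "\<dots> = ennreal (q ?ns)"
  proof -
    have pos: "0 \<le> (\<integral>\<omega>. (\<Prod>i<length ?ns. V \<omega> (js ! i) ^ (?ns ! i)) \<partial>M)" for js
      by (auto intro!: integral_nonneg_AE prod_nonneg simp: V_nonneg)
    note sum = has_sum_eppf[OF sp dec ns]
    have q0: "0 \<le> q ?ns" by (rule has_sum_nonneg[OF sum pos])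
    show ?thesis
      using iffD1[OF has_sum_iff_nn_integral_count_space[where
        f="\<lambda>js. \<integral>\<omega>. (\<Prod>i<length ?ns. V \<omega> (js ! i) ^ (?ns ! i)) \<partial>M", OF pos q0] sum]
      by (simp add: b(2))
  qed
  finally have eq: "emeasure M {\<omega>\<in>space M. kernel_partition n (\<lambda>j. I j \<omega>) = \<pi>} = ennreal (q ?ns)" .
  have "0 \<le> q ?ns"
    by (rule has_sum_nonneg[OF has_sum_eppf[OF sp dec ns]])
      (auto intro!: integral_nonneg_AE prod_nonneg simp: V_nonneg)
  then show ?thesis using eq by (simp add: eppf_at_def measure_def)
qed

end

section \<open>The three claims\<close>

lemma prod_blocks:
  assumes "\<pi> \<in> partitions n"
  shows "(\<Prod>c<card \<pi>. g (blocks \<pi> ! c)) = (\<Prod>B\<in>\<pi>. g B)"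
proof -
  note b = blocks_partition[OF assms]
  have "bij_betw ((!) (blocks \<pi>)) {..<card \<pi>} \<pi>"
    using bij_betw_nth[OF b(3)] b(1,2) by auto
  then show ?thesis by (rule prod.reindex_bij_betw)
qed

theorem proposition1:
  fixes M :: "'w measure"
    and H :: "'x::polish_space measure"
    and q :: "nat list \<Rightarrow> real"
    and p :: "'w \<Rightarrow> 'x measure"
    and w wdec :: "nat \<Rightarrow> 'w \<Rightarrow> real"
    and Z \<xi> \<xi>' :: "nat \<Rightarrow> 'w \<Rightarrow> 'x"
    and I :: "nat \<Rightarrow> 'w \<Rightarrow> nat"
    and P :: "nat \<Rightarrow> 'w \<Rightarrow> nat set set"
  defines "\<G> \<equiv> sigma_gen M (PiM UNIV (\<lambda>_. borel)) (\<lambda>\<omega> k. wdec k \<omega>)"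
    and "\<xi> \<equiv> \<lambda>n \<omega>. Z (I n \<omega>) \<omega>"
    and "\<xi>' \<equiv> \<lambda>n \<omega>. Z (block_index P n \<omega>) \<omega>"
  assumes "prob_space M"
    and "prob_space H" and "sets H = sets borel"
    and "species_sampling M q H p w Z"
    and "\<And>k. wdec k \<in> borel_measurable M"
    and "AE \<omega> in M. decreasing_rearrangement (\<lambda>j. w j \<omega>) (\<lambda>k. wdec k \<omega>)"
    and "cond_indep_seq M \<G> (count_space UNIV) I"
    and "\<And>n j. AE \<omega> in M. prob_given M \<G> {\<omega>\<in>space M. I n \<omega> = j} \<omega> = wdec j \<omega>"
    and "indep_rv M (PiM UNIV (\<lambda>_. count_space UNIV)) (\<lambda>\<omega> n. I n \<omega>)
                  (PiM UNIV (\<lambda>_. borel)) (\<lambda>\<omega> j. Z j \<omega>)"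
    and "exchangeable_partition M P" and "has_eppf M P q"
    and "indep_rv M (PiM UNIV (\<lambda>n. count_space (partitions n))) (\<lambda>\<omega> n. P n \<omega>)
                  (PiM UNIV (\<lambda>_. borel)) (\<lambda>\<omega> j. Z j \<omega>)"
  shows "gSSS M q H \<xi> \<and>
    distr M (PiM UNIV (\<lambda>_. borel)) (\<lambda>\<omega> n. \<xi> n \<omega>) =
      distr M (PiM UNIV (\<lambda>_. borel)) (\<lambda>\<omega> n. \<xi>' n \<omega>) \<and>
    (\<forall>n\<ge>1. \<forall>A. (\<forall>j<n. A j \<in> sets borel) \<longrightarrow>
      measure M {\<omega>\<in>space M. \<forall>j<n. \<xi> j \<omega> \<in> A j} =
        (\<Sum>\<pi>\<in>partitions n. eppf_at q \<pi> *
           (\<Prod>c<card \<pi>. measure H (\<Inter>j\<in>blocks \<pi> ! c. A j))))"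
proof -
  interpret prob_space M by fact
  note sp = assms(7) and dec = assms(9) and IZ = assms(12)
  have P: "random_partition M P" using assms(13) by (simp add: exchangeable_partition_def)
  interpret conditional_sampling M wdec I
  proof
    show "AE \<omega> in M. \<forall>k. 0 \<le> wdec k \<omega>"
      using dec by eventually_elim (simp add: decreasing_rearrangement_def)
  qed (use assms in \<open>simp_all add: \<G>_def\<close>)
  obtain F where F: "F \<in> PiM UNIV (\<lambda>_. count_space UNIV) \<rightarrow>\<^sub>M PiM UNIV (\<lambda>_. borel)"
    "\<And>i. proper_weights (F i)" "AE \<omega> in M. F (\<lambda>n. I n \<omega>) = (\<lambda>k. wdec k \<omega>)"
    by (rule weights_of_indices) (rule that)
  interpret S: species_sampling_sequence M wdec I Z F
    by unfold_locales (use IZ F in auto)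
  have Zind: "indep_vars (\<lambda>_. borel) Z UNIV" and H: "\<And>j. distr M borel (Z j) = H"
    using sp by (auto simp: species_sampling_def)
  note PZ = indep_rv_block_index[OF prob_space_axioms P assms(15)]
  have block_meas: "(\<lambda>\<omega>. block_index P n \<omega>) \<in> M \<rightarrow>\<^sub>M count_space UNIV" for n
    using PZ measurable_compose[OF _ measurable_component_singleton[of n]] by (auto simp: indep_rv_def)
  have prob: "measure M {\<omega>\<in>space M. \<forall>j<n. \<xi> j \<omega> \<in> A j} =
      (\<Sum>\<pi>\<in>partitions n. eppf_at q \<pi> * (\<Prod>B\<in>\<pi>. measure H (\<Inter>j\<in>B. A j)))"
    if n: "1 \<le> n" and A: "\<And>j. j < n \<Longrightarrow> A j \<in> sets borel" for n A
    unfolding \<xi>_def by (subst prob_indexed_atoms[OF prob_space_axioms Zind H A IZ], assumption)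
       (auto intro!: sum.cong simp: S.prob_kernel_partition[OF sp dec n])
  have prob': "measure M {\<omega>\<in>space M. \<forall>j<n. \<xi>' j \<omega> \<in> A j} =
      (\<Sum>\<pi>\<in>partitions n. eppf_at q \<pi> * (\<Prod>B\<in>\<pi>. measure H (\<Inter>j\<in>B. A j)))"
    if n: "1 \<le> n" and A: "\<And>j. j < n \<Longrightarrow> A j \<in> sets borel" for n A
    unfolding \<xi>'_def
  proof (subst prob_indexed_atoms[OF prob_space_axioms Zind H A PZ], assumption, intro sum.cong refl)
    fix \<pi> assume \<pi>: "\<pi> \<in> partitions n"
    \<comment> \<open>The block indices induce the given partition itself, so its EPPF supplies the
      probability directly.\<close>
    have "{\<omega>\<in>space M. kernel_partition n (\<lambda>j. block_index P j \<omega>) = \<pi>} = {\<omega>\<in>space M. P n \<omega> = \<pi>}"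
      using kernel_partition_block_index[OF P] by auto
    then show "measure M {\<omega>\<in>space M. kernel_partition n (\<lambda>j. block_index P j \<omega>) = \<pi>} *
        (\<Prod>B\<in>\<pi>. measure H (\<Inter>j\<in>B. A j)) = eppf_at q \<pi> * (\<Prod>B\<in>\<pi>. measure H (\<Inter>j\<in>B. A j))"
      using assms(14) n \<pi> by (simp add: has_eppf_def)
  qed
  have "distr M (PiM UNIV (\<lambda>_. borel)) (\<lambda>\<omega> n. \<xi> n \<omega>) = distr M (PiM UNIV (\<lambda>_. borel)) (\<lambda>\<omega> n. \<xi>' n \<omega>)"
  proof (rule distr_PiM_eqI[OF prob_space_axioms])
    show "\<xi> n \<in> borel_measurable M" for n unfolding \<xi>_def by (rule S.atom_measurable)
    show "\<xi>' n \<in> borel_measurable M" for n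
      unfolding \<xi>'_def by (rule measurable_apply_index[OF block_meas S.Z_seq_measurable])
    fix J and A :: "nat \<Rightarrow> 'x set" assume J: "finite J" and A: "\<And>i. i \<in> J \<Longrightarrow> A i \<in> sets borel"
    \<comment> \<open>The formulas are for initial segments of positions, so the other positions
      below \<open>n\<close> receive the trivial condition.\<close>
    define A' where "A' i = (if i \<in> J then A i else UNIV)" for i
    \<comment> \<open>\<open>insert 0\<close> covers an empty \<open>J\<close>, and the successor
      makes \<open>n\<close> at least 1 and larger than every element of \<open>J\<close>.\<close>
    define n where "n = Suc (Max (insert 0 J))"
    have "i < n" if "i \<in> J" for i using J that by (simp add: n_def less_Suc_eq_le)
    then have "{\<omega>\<in>space M. \<forall>i\<in>J. X i \<omega> \<in> A i} = {\<omega>\<in>space M. \<forall>i<n. X i \<omega> \<in> A' i}" for X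
      by (auto simp: A'_def)
    moreover have "A' i \<in> sets borel" for i using A by (simp add: A'_def)
    ultimately show "emeasure M {\<omega>\<in>space M. \<forall>i\<in>J. \<xi> i \<omega> \<in> A i} = emeasure M {\<omega>\<in>space M. \<forall>i\<in>J. \<xi>' i \<omega> \<in> A i}"
      using prob[of n A'] prob'[of n A'] by (simp add: emeasure_eq_measure n_def)
  qed
  moreover have "measure M {\<omega>\<in>space M. \<forall>j<n. \<xi> j \<omega> \<in> A j} =
      (\<Sum>\<pi>\<in>partitions n. eppf_at q \<pi> * (\<Prod>c<card \<pi>. measure H (\<Inter>j\<in>blocks \<pi> ! c. A j)))"
    if "1 \<le> n" "\<forall>j<n. A j \<in> sets borel" for n A
    using prob[of n A] that prod_blocks[of _ n "\<lambda>B. measure H (\<Inter>j\<in>B. A j)"] by simp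
  moreover have "gSSS M q H \<xi>"
    unfolding \<xi>_def by (rule S.gSSS_atoms[OF sp dec])
  ultimately show ?thesis by blast
qed

end
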